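(* Let $p\in(1,\infty)$ and $p'=\frac{p}{p-1}$. Let $\mathcal{O}$ be a closed convex subset of $\mathbb{R}^d$ and let $K$ be a nonempty, closed, coupling convex, bounded subset of $\mathcal{P}_p(\mathcal{O})$. Then, for every u.s.c. function $f:K\to\mathbb{R}$ that is bounded from above and every $\varepsilon>0$, there exists $\xi\in\mathcal{P}_{p'}(\mathbb{R}^d)$ with $M_{p'}(\xi)\le\varepsilon$ such that $$\mu\mapsto f(\mu)-\mathcal{I}_p(\xi,\mu)$$ has a strongly exposed point of maximum on $K$.
   Context: $\mathcal{P}_p(\mathbb{R}^d)$ is the set of Borel probability measures on $\mathbb{R}^d$ with finite $p$-th moment, endowed with the $p$-Wasserstein distance $\mathcal{W}_p$; $\mathcal{P}_p(\mathcal{O})$ is the subset of those concentrated on $\mathcal{O}$. Closedness, boundedness, upper semicontinuity and convergence are with respect to $\mathcal{W}_p$. $M_{p'}(\xi)=\int|x|^{p'}\xi(dx)$. $\Pi(\mu,\nu)$ is the set of couplings of $\mu$ and $\nu$. For $\xi\in\mathcal{P}_{p'}(\mathbb{R}^d)$, $\mu\in\mathcal{P}_p(\mathbb{R}^d)$, $$\mathcal{I}_p(\xi,\mu)=\inf_{\gamma\in\Pi(\xi,\mu)}-\int_{\mathbb{R}^d\times\mathbb{R}^d}x\cdot y\,\gamma(dx,dy).$$ A set $A\subset\mathcal{P}_p(\mathbb{R}^d)$ is coupling convex if for all $\mu,\nu\in A$, $\theta\in[0,1]$ and $\gamma\in\Pi(\mu,\nu)$, one has $((1-\theta)\pi_1+\theta\pi_2)_\#\gamma\in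 A$, where $\pi_1,\pi_2$ are the coordinate projections and $\#$ denotes push-forward. A strongly exposed point of maximum of $g:K\to\mathbb{R}$ is a point of maximum $x_*\in K$ such that every sequence $(x_n)$ in $K$ with $g(x_n)\to\sup_K g$ converges to $x_*$. *)

theory Defs
  imports "HOL-Probability.Probability"
begin

definition finite_moment_measures :: "real \<Rightarrow> 'a::euclidean_space measure set" where
  "finite_moment_measures p =
     {\<mu>. prob_space \<mu> \<and> sets \<mu> = sets borel \<and> integrable \<mu> (\<lambda>x. norm x powr p)}"

definition finite_moment_measures_on :: "real \<Rightarrow> 'a::euclidean_space set \<Rightarrow> 'a measure set" where
  "finite_moment_measures_on p S = {\<mu> \<in> finite_moment_measures p. AE x in \<mu>. x \<in> S}"

definition moment :: "real \<Rightarrow> 'a::euclidean_space measure \<Rightarrow> real" where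
  "moment p \<mu> = (\<integral>x. norm x powr p \<partial>\<mu>)"

definition couplings ::
  "'a::euclidean_space measure \<Rightarrow> 'a measure \<Rightarrow> ('a \<times> 'a) measure set" where
  "couplings \<mu> \<nu> =
     {\<gamma>. prob_space \<gamma> \<and> sets \<gamma> = sets borel \<and> distr \<gamma> borel fst = \<mu> \<and> distr \<gamma> borel snd = \<nu>}"

text \<open>
  The two real-valued infima below are genuine ones on the domains on which they are used: the
  set of couplings of two probability measures contains their product, and the integrands are
  integrable for every coupling, the first when both measures have finite \<open>p\<close>-th moment, the
  second (Hoelder) when they have finite moments of conjugate exponents.
\<close>

definition wasserstein :: "real \<Rightarrow> 'a::euclidean_space measure \<Rightarrow> 'a measure \<Rightarrow> real" where
  "wasserstein p \<mu> \<nu> =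
     (INF \<gamma>\<in>couplings \<mu> \<nu>. \<integral>z. dist (fst z) (snd z) powr p \<partial>\<gamma>) powr (1 / p)"

text \<open>The exponent does not enter the formula; it only determines the domain.\<close>

definition correlation_cost :: "'a::euclidean_space measure \<Rightarrow> 'a measure \<Rightarrow> real" where
  "correlation_cost \<xi> \<mu> = (INF \<gamma>\<in>couplings \<xi> \<mu>. - (\<integral>z. fst z \<bullet> snd z \<partial>\<gamma>))"

definition coupling_convex :: "'a::euclidean_space measure set \<Rightarrow> bool" where
  "coupling_convex A \<longleftrightarrow>
     (\<forall>\<mu>\<in>A. \<forall>\<nu>\<in>A. \<forall>\<theta>\<in>{0..1}. \<forall>\<gamma>\<in>couplings \<mu> \<nu>.
        distr \<gamma> borel (\<lambda>z. (1 - \<theta>) *\<^sub>R fst z + \<theta> *\<^sub>R snd z) \<in> A)"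

text \<open>
  The metric notions for \<open>wasserstein p\<close> are spelled out, as in \<open>Metric_space.closedin_metric\<close>
  and \<open>Metric_space.mbounded_def\<close>, because using the locale \<open>Metric_space\<close> would presuppose the
  triangle inequality. The argument \<open>M\<close> is the ambient space.
\<close>

definition wasserstein_closed_in ::
  "real \<Rightarrow> 'a::euclidean_space measure set \<Rightarrow> 'a measure set \<Rightarrow> bool" where
  "wasserstein_closed_in p M K \<longleftrightarrow>
     K \<subseteq> M \<and> (\<forall>\<mu>\<in>M - K. \<exists>r>0. \<forall>\<nu>\<in>K. \<not> wasserstein p \<mu> \<nu> < r)"

definition wasserstein_bounded_in ::
  "real \<Rightarrow> 'a::euclidean_space measure set \<Rightarrow> 'a measure set \<Rightarrow> bool" where
  "wasserstein_bounded_in p M K \<longleftrightarrow>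
     K \<subseteq> M \<and> (\<exists>\<mu>\<in>M. \<exists>C. \<forall>\<nu>\<in>K. wasserstein p \<mu> \<nu> \<le> C)"

definition wasserstein_usc_on ::
  "real \<Rightarrow> 'a::euclidean_space measure set \<Rightarrow> ('a measure \<Rightarrow> real) \<Rightarrow> bool" where
  "wasserstein_usc_on p K f \<longleftrightarrow>
     (\<forall>\<mu>\<in>K. \<forall>e>0. \<exists>r>0. \<forall>\<nu>\<in>K. wasserstein p \<mu> \<nu> < r \<longrightarrow> f \<nu> < f \<mu> + e)"

definition strongly_exposed_max ::
  "real \<Rightarrow> 'a::euclidean_space measure set \<Rightarrow> ('a measure \<Rightarrow> real) \<Rightarrow> 'a measure \<Rightarrow> bool" where
  "strongly_exposed_max p K g \<mu> \<longleftrightarrow>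
     \<mu> \<in> K \<and> (\<forall>\<nu>\<in>K. g \<nu> \<le> g \<mu>) \<and>
     (\<forall>s. (\<forall>n. s n \<in> K) \<and> (\<lambda>n. g (s n)) \<longlonglongrightarrow> (SUP \<nu>\<in>K. g \<nu>)
        \<longrightarrow> (\<lambda>n. wasserstein p (s n) \<mu>) \<longlonglongrightarrow> 0)"

end

theory Submission
  imports Defs
begin

text \<open>
  Read measures as laws of random variables. Over a sufficiently rich probability space, if \<open>Y\<close> has
  law \<open>\<xi>\<close>, then \<open>f \<mu> - correlation_cost \<xi> \<mu>\<close> is the supremum of \<open>f (law X) + E[Y \<bullet> X]\<close> over the
  random variables \<open>X\<close> with law \<open>\<mu>\<close>. The theorem therefore follows from Stegall's variational
  principle in \<open>L\<^sup>p\<close>: on the closed bounded set \<open>C\<close> of all \<open>X\<close> with law in \<open>K\<close>, the function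
  \<open>F X = f (law X)\<close> plus a suitable small linear functional \<open>Y\<close> in the dual \<open>L\<^sup>p\<^sup>'\<close> has a maximum to
  which all maximizing sequences converge.

  Stegall's principle has a direct proof here. Let \<open>d(x, z)\<close> be the Bregman divergence of \<open>|x|\<^sup>p\<close>, that
  is, \<open>|x|\<^sup>p\<close> minus its tangent at \<open>z\<close>, and let \<open>D(X, Z) = E d(X, Z)\<close>. Strict convexity makes
  \<open>d(x, z)\<close> vanish only for \<open>x = z\<close>, and by homogeneity and compactness \<open>D\<close> controls \<open>E |X - Z|\<^sup>p\<close> on
  bounded sets (\<open>expectation_diff_powr_le_bregman\<close>). The iterative
  \<open>divergence_variational_principle\<close>, in the manner of Borwein and Preiss, perturbs a function \<open>H\<close> that
  is bounded above to \<open>H - \<Sum>\<^sub>i a\<^sub>i D(\<sqdot>, X\<^sub>i)\<close>, all of whose almost maximizers are close to one another.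
  For \<open>H X = F X + (\<Sum>\<^sub>i a\<^sub>i) E |X|\<^sup>p\<close> the powers cancel, because \<open>D(X, Z) - E |X|\<^sup>p\<close> is affine in \<open>X\<close>:
  what remains is \<open>F X + E[Y \<bullet> X]\<close> up to a constant, with \<open>Y = p \<Sum>\<^sub>i a\<^sub>i |X\<^sub>i|\<^sup>p\<^sup>-\<^sup>2 X\<^sub>i\<close>, which is as small
  as desired (\<open>duality_series\<close>, \<open>stegall_random_variables\<close>). Completeness of \<open>L\<^sup>p\<close> and upper
  semicontinuity then provide the maximum point.

  The rich probability space is the product of uncountably many copies of every law. An event depends
  on countably many coordinates only, so for a countable partition into events there are always
  coordinates that are independent of each of its members. Selecting one such coordinate on each small
  cell of values of \<open>Y\<close> realizes any coupling of the law of \<open>Y\<close> up to an arbitrarily small error in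
  \<open>E[Y \<bullet> X]\<close>, with exact second marginal (\<open>exists_nearly_optimal_variable\<close>).
\<close>

section \<open>The Bregman divergence of the power of the norm\<close>

lemma exp_gt_add_one_self:
  fixes x :: real
  assumes "x \<noteq> 0"
  shows "1 + x < exp x"
proof -
  have "exp x = exp (x / 2) * exp (x / 2)"
    by (simp flip: exp_add)
  moreover have "(1 + x / 2)\<^sup>2 = 1 + x + x\<^sup>2 / 4"
    by (simp add: power2_eq_square algebra_simps)
  moreover have "x\<^sup>2 > 0"
    using assms by simp
  ultimately show ?thesis
  proof (cases "1 + x / 2 \<ge> 0")
    case True
    have "(1 + x / 2)\<^sup>2 \<le> (exp (x / 2))\<^sup>2"
      using True exp_ge_add_one_self by (rule power_mono[rotated])
    then show ?thesis
      using \<open>exp x = _\<close> \<open>(1 + x / 2)\<^sup>2 = _\<close> \<open>x\<^sup>2 > 0\<close> by (simp add: power2_eq_square)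
  next
    case False
    then show ?thesis
      using exp_gt_zero[of x] by linarith
  qed
qed

text \<open>
  Strict convexity of the power function: it lies strictly above its tangent at \<open>t\<close>. With
  \<open>s = t e\<^sup>v\<close> the claim is \<open>p e\<^sup>v < e\<^sup>p\<^sup>v + p - 1\<close>, and this is the sum of the inequalities
  \<open>e\<^sup>v (1 + (p - 1) v) < e\<^sup>p\<^sup>v\<close> and \<open>(p - 1) e\<^sup>v (1 - v) < p - 1\<close>, both of which come from \<open>1 + x < e\<^sup>x\<close>.
\<close>

lemma powr_above_tangent:
  fixes p s t :: real
  assumes "1 < p" "0 \<le> s" "0 \<le> t" "s \<noteq> t"
  shows "p * t powr (p - 1) * s < s powr p + (p - 1) * t powr p"
proof -
  consider "t = 0" | "t > 0" "s = 0" | "s > 0" "t > 0"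
    using assms by linarith
  then show ?thesis
  proof cases
    case 1
    then show ?thesis using assms by simp
  next
    case 2
    then show ?thesis using assms by simp
  next
    case 3
    define v where "v = ln s - ln t"
    have "v \<noteq> 0"
      using assms 3 by (simp add: v_def)
    have sp: "s powr p = t powr p * exp (p * v)"
      using 3 by (simp add: powr_def v_def right_diff_distrib flip: exp_add)
    have ts: "t powr (p - 1) * s = t powr p * exp v"
    proof -
      have "s = t * exp v"
        using 3 by (simp add: v_def exp_diff)
      moreover have "t powr p = t powr (p - 1) * t"
        using 3 powr_mult_base[of t "p - 1"] by (simp add: mult.commute)
      ultimately show ?thesis by simp
    qed
    have "exp v * (1 + (p - 1) * v) < exp v * exp ((p - 1) * v)"
      using exp_gt_add_one_self[of "(p - 1) * v"] \<open>v \<noteq> 0\<close> assms(1) by simp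
    moreover have "exp v * exp ((p - 1) * v) = exp (p * v)"
      by (simp add: algebra_simps flip: exp_add)
    moreover have "exp v * (1 - v) < 1"
    proof -
      have "exp v * (1 + - v) < exp v * exp (- v)"
        using exp_gt_add_one_self[of "- v"] \<open>v \<noteq> 0\<close> by simp
      then show ?thesis by (simp flip: exp_add)
    qed
    then have "(p - 1) * (exp v * (1 - v)) < (p - 1) * 1"
      using assms(1) by (intro mult_strict_left_mono) auto
    ultimately have "p * exp v < exp (p * v) + (p - 1)"
      by (simp add: algebra_simps)
    then have "t powr p * (p * exp v) < t powr p * (exp (p * v) + (p - 1))"
      using 3 by simp
    then show ?thesis
      using sp ts by (simp add: algebra_simps)
  qed
qed

lemma powr_ge_tangent:
  fixes p s t :: real
  assumes "1 < p" "0 \<le> s" "0 \<le> t"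
  shows "p * t powr (p - 1) * s \<le> s powr p + (p - 1) * t powr p"
proof (cases "s = t")
  case True
  have "t powr (p - 1) * t = t powr p"
    using assms powr_mult_base[of t "p - 1"] by (simp add: mult.commute)
  then show ?thesis
    using True by (simp add: algebra_simps)
next
  case False
  then show ?thesis using powr_above_tangent[OF assms False] by simp
qed

text \<open>
  This is \<open>1 / p\<close> times the gradient of \<open>|z|\<^sup>p\<close>. The value at the origin is \<open>0\<close> also for \<open>p < 2\<close>.
\<close>

definition duality_map :: "real \<Rightarrow> 'a::euclidean_space \<Rightarrow> 'a" where
  "duality_map p z = norm z powr (p - 2) *\<^sub>R z"

lemma norm_duality_map: "norm (duality_map p z) = norm z powr (p - 1)"
proof (cases "z = 0")
  case False
  have "norm z powr (p - 2) * norm z = norm z powr (p - 1)"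
    using powr_mult_base[of "norm z" "p - 2"] by (simp add: mult.commute)
  then show ?thesis by (simp add: duality_map_def)
qed (simp add: duality_map_def)

lemma duality_map_inner_self: "1 < p \<Longrightarrow> duality_map p z \<bullet> z = norm z powr p"
proof -
  assume "1 < p"
  have "norm z powr (p - 2) * (norm z * norm z) = norm z powr p"
    using powr_mult_base[of "norm z" "p - 2"] powr_mult_base[of "norm z" "p - 1"]
    by (simp add: mult_ac)
  then show ?thesis
    by (simp add: duality_map_def flip: power2_norm_eq_inner) (simp add: power2_eq_square)
qed

lemma continuous_duality_map:
  assumes "1 < p"
  shows "continuous_on UNIV (duality_map p :: 'a::euclidean_space \<Rightarrow> 'a)"
proof -
  have "isCont (duality_map p) z" for z :: 'a
  proof (cases "z = 0")
    case False
    then show ?thesis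
      unfolding duality_map_def by (intro continuous_intros) auto
  next
    case True
    have "((\<lambda>y::'a. norm y powr (p - 1)) \<longlongrightarrow> norm (0::'a) powr (p - 1)) (at 0)"
      using assms by (intro tendsto_powr' tendsto_intros) auto
    then have "((\<lambda>y::'a. norm (duality_map p y)) \<longlongrightarrow> 0) (at 0)"
      by (simp add: norm_duality_map)
    then have "((\<lambda>y::'a. duality_map p y) \<longlongrightarrow> 0) (at 0)"
      by (rule tendsto_norm_zero_cancel)
    then show ?thesis
      unfolding True isCont_def by (simp add: duality_map_def[of p 0])
  qed
  then show ?thesis
    by (simp add: continuous_on_eq_continuous_at)
qed

lemma duality_map_scaleR:
  "0 \<le> r \<Longrightarrow> duality_map p (r *\<^sub>R z) = r powr (p - 1) *\<^sub>R duality_map p z"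
  using powr_mult_base[of r "p - 2"]
  by (simp add: duality_map_def powr_mult) (simp add: mult_ac)

text \<open>
  The formula is \<open>|x|\<^sup>p - |z|\<^sup>p - p duality_map(z) \<bullet> (x - z)\<close>, simplified by
  \<open>duality_map(z) \<bullet> z = |z|\<^sup>p\<close>.
\<close>

definition bregman :: "real \<Rightarrow> 'a::euclidean_space \<Rightarrow> 'a \<Rightarrow> real" where
  "bregman p x z = norm x powr p + (p - 1) * norm z powr p - p * (duality_map p z \<bullet> x)"

lemma abs_duality_map_inner_le:
  "\<bar>p * (duality_map p z \<bullet> x)\<bar> \<le> norm x powr p + (p - 1) * norm z powr p" if "1 < p"
proof -
  have "\<bar>duality_map p z \<bullet> x\<bar> \<le> norm z powr (p - 1) * norm x"
    using Cauchy_Schwarz_ineq2[of "duality_map p z" x] by (simp add: norm_duality_map)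
  then have "\<bar>p * (duality_map p z \<bullet> x)\<bar> \<le> p * (norm z powr (p - 1) * norm x)"
    using that by (simp add: abs_mult)
  also have "\<dots> \<le> norm x powr p + (p - 1) * norm z powr p"
    using powr_ge_tangent[of p "norm x" "norm z"] that by simp
  finally show ?thesis .
qed

lemma bregman_nonneg: "1 < p \<Longrightarrow> 0 \<le> bregman p x z"
  using abs_duality_map_inner_le[of p z x] by (simp add: bregman_def)

lemma bregman_le: "1 < p \<Longrightarrow> bregman p x z \<le> 2 * (norm x powr p + (p - 1) * norm z powr p)"
  using abs_duality_map_inner_le[of p z x] by (simp add: bregman_def)

lemma bregman_self: "1 < p \<Longrightarrow> bregman p x x = 0"
  by (simp add: bregman_def duality_map_inner_self algebra_simps)

text \<open>
  Equality would force equality both in the tangent inequality, hence \<open>|x| = |z|\<close>, and in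
  Cauchy-Schwarz, hence \<open>x = z\<close>.
\<close>

lemma bregman_pos:
  assumes "1 < p" "x \<noteq> z"
  shows "0 < bregman p x z"
proof (cases "norm x = norm z")
  case False
  have "duality_map p z \<bullet> x \<le> norm z powr (p - 1) * norm x"
    using norm_cauchy_schwarz[of "duality_map p z" x] by (simp add: norm_duality_map)
  then have "p * (duality_map p z \<bullet> x) \<le> p * (norm z powr (p - 1) * norm x)"
    using assms(1) by simp
  also have "\<dots> < norm x powr p + (p - 1) * norm z powr p"
    using powr_above_tangent[of p "norm x" "norm z"] assms False by simp
  finally show ?thesis by (simp add: bregman_def)
next
  case True
  then have "z \<noteq> 0"
    using assms(2) by auto
  have "z \<bullet> x < norm z * norm z"
  proof -
    have "z \<bullet> x \<noteq> norm z * norm x"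
      using norm_cauchy_schwarz_eq[of z x] assms(2) True \<open>z \<noteq> 0\<close> by auto
    then show ?thesis
      using norm_cauchy_schwarz[of z x] True by (simp add: less_le)
  qed
  then have "norm z powr (p - 2) * (z \<bullet> x) < norm z powr (p - 2) * (z \<bullet> z)"
    using \<open>z \<noteq> 0\<close> by (intro mult_strict_left_mono)
      (auto simp flip: power2_norm_eq_inner simp: power2_eq_square)
  then have "duality_map p z \<bullet> x < norm z powr p"
    using duality_map_inner_self[of p z] assms by (simp add: duality_map_def)
  then have "p * (duality_map p z \<bullet> x) < p * norm z powr p"
    using assms by simp
  then show ?thesis
    by (simp add: bregman_def True algebra_simps)
qed

lemma bregman_scaleR:
  assumes "0 \<le> r"
  shows "bregman p (r *\<^sub>R x) (r *\<^sub>R z) = r powr p * bregman p x z"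
proof -
  have "r powr (p - 1) * r = r powr p"
    using assms powr_mult_base[of r "p - 1"] by (simp add: mult.commute)
  moreover have "duality_map p (r *\<^sub>R z) \<bullet> (r *\<^sub>R x) = (r powr (p - 1) * r) * (duality_map p z \<bullet> x)"
    using assms by (simp add: duality_map_scaleR)
  ultimately show ?thesis
    using assms by (simp add: bregman_def powr_mult algebra_simps)
qed

text \<open>
  Both sides are homogeneous of degree \<open>p\<close>, so it suffices to treat pairs with \<open>|x|\<^sup>p + |z|\<^sup>p = 1\<close>.
  Those with \<open>|x - z|\<^sup>p \<ge> e\<close> form a compact set on which the divergence is positive, so the quotient
  \<open>|x - z|\<^sup>p / bregman\<close> has a maximum there, which serves as \<open>C\<close>. This argument treats \<open>p < 2\<close> and
  \<open>p \<ge> 2\<close> alike.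
\<close>

lemma norm_diff_powr_le_bregman:
  fixes p e :: real
  assumes "1 < p" "0 < e"
  shows "\<exists>C\<ge>0. \<forall>x z :: 'a::euclidean_space.
           norm (x - z) powr p \<le> e * (norm x powr p + norm z powr p) + C * bregman p x z"
proof -
  let ?N = "\<lambda>w::'a \<times> 'a. norm (fst w) powr p + norm (snd w) powr p"
  let ?d = "\<lambda>w::'a \<times> 'a. norm (fst w - snd w) powr p"
  let ?b = "\<lambda>w::'a \<times> 'a. bregman p (fst w) (snd w)"
  define S where "S = {w. ?N w = 1 \<and> e \<le> ?d w}"
  have cN: "continuous_on UNIV ?N" and cd: "continuous_on UNIV ?d"
    using assms by (intro continuous_intros continuous_on_powr'; auto)+
  have cb: "continuous_on UNIV ?b"
    unfolding bregman_def using assms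
    by (intro continuous_intros continuous_on_powr'
        continuous_on_compose2[OF continuous_duality_map]) auto
  have "S \<subseteq> cball 0 1 \<times> cball 0 1"
  proof
    fix w assume "w \<in> S"
    then have "norm (fst w) powr p + norm (snd w) powr p = 1"
      by (simp add: S_def)
    moreover have "1 < r powr p" if "1 < r" for r
      using that assms by (simp add: gr_one_powr)
    ultimately have "norm (fst w) \<le> 1" "norm (snd w) \<le> 1"
      using powr_ge_zero[of "norm (fst w)" p] powr_ge_zero[of "norm (snd w)" p]
      by (smt (verit))+
    then show "w \<in> cball 0 1 \<times> cball 0 1"
      by (simp add: mem_Times_iff)
  qed
  then have "bounded S"
    using bounded_Times bounded_cball bounded_subset by blast
  moreover have "closed S"
    unfolding S_def Collect_conj_eq using cN cd
    by (intro closed_Int closed_Collect_eq closed_Collect_le) (auto intro: continuous_intros)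
  ultimately have "compact S"
    by (simp add: compact_eq_bounded_closed)
  have "\<exists>C\<ge>0. \<forall>w\<in>S. ?d w \<le> C * ?b w"
  proof (cases "S = {}")
    case False
    have pos: "0 < ?b w" if "w \<in> S" for w
      using that assms by (intro bregman_pos) (auto simp: S_def)
    let ?q = "\<lambda>w. ?d w / ?b w"
    have "continuous_on S ?q"
      using cd cb pos by (intro continuous_on_divide) (auto intro: continuous_on_subset simp: less_imp_neq[symmetric])
    then obtain w0 where "w0 \<in> S" "\<And>w. w \<in> S \<Longrightarrow> ?q w \<le> ?q w0"
      using continuous_attains_sup[OF \<open>compact S\<close> False] by blast
    then show ?thesis
      using pos by (intro exI[of _ "?q w0"]) (auto simp: field_simps less_imp_le)
  qed auto
  then obtain C where C: "C \<ge> 0" "\<And>w. w \<in> S \<Longrightarrow> ?d w \<le> C * ?b w"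
    by blast
  have unit: "?d w \<le> e + C * ?b w" if "?N w = 1" for w
  proof (cases "w \<in> S")
    case True
    then show ?thesis using C assms by fastforce
  next
    case False
    then have "?d w \<le> e"
      using that by (auto simp: S_def)
    moreover have "0 \<le> C * ?b w"
      using C(1) assms by (intro mult_nonneg_nonneg bregman_nonneg)
    ultimately show ?thesis by linarith
  qed
  have "norm (x - z) powr p \<le> e * (norm x powr p + norm z powr p) + C * bregman p x z" for x z :: 'a
  proof (cases "norm x powr p + norm z powr p = 0")
    case True
    then have "x = 0" "z = 0"
      by (simp_all add: add_nonneg_eq_0_iff)
    then show ?thesis using assms by (simp add: bregman_self)
  next
    case False
    define n where "n = norm x powr p + norm z powr p"
    have "n > 0"
      using False by (simp add: n_def less_le add_nonneg_nonneg)
    define r where "r = n powr (- 1 / p)"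
    have "r > 0"
      using \<open>n > 0\<close> by (simp add: r_def)
    have "r powr p = n powr (- 1)"
      using assms by (simp only: r_def powr_powr) simp
    then have "r powr p = 1 / n"
      using \<open>n > 0\<close> by (simp add: powr_minus_divide)
    have "?N (r *\<^sub>R x, r *\<^sub>R z) = r powr p * n"
      using \<open>r > 0\<close> by (simp add: powr_mult n_def algebra_simps)
    then have "?N (r *\<^sub>R x, r *\<^sub>R z) = 1"
      using \<open>r powr p = 1 / n\<close> \<open>n > 0\<close> by simp
    from unit[OF this] have "r powr p * norm (x - z) powr p \<le> e + C * (r powr p * bregman p x z)"
      using \<open>r > 0\<close> by (simp add: bregman_scaleR powr_mult flip: scaleR_diff_right)
    then have "n * (r powr p * norm (x - z) powr p) \<le> n * (e + C * (r powr p * bregman p x z))"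
      using \<open>n > 0\<close> by (intro mult_left_mono) auto
    moreover have "n * (r powr p * norm (x - z) powr p) = norm (x - z) powr p"
      using \<open>r powr p = 1 / n\<close> \<open>n > 0\<close> by simp
    ultimately have "norm (x - z) powr p \<le> n * (e + C * (r powr p * bregman p x z))"
      by simp
    also have "\<dots> = e * n + C * bregman p x z * (n * r powr p)"
      by (simp add: algebra_simps)
    also have "n * r powr p = 1"
      using \<open>r powr p = 1 / n\<close> \<open>n > 0\<close> by simp
    finally show ?thesis by (simp add: n_def)
  qed
  then show ?thesis using C(1) by blast
qed

section \<open>Pairing and differences of random variables with finite moments\<close>

text \<open>
  Young's inequality, with constants that are not optimal. It is the tangent inequality at
  \<open>t = |y|\<^sup>1\<^sup>/\<^sup>(\<^sup>p\<^sup>-\<^sup>1\<^sup>)\<close>.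
\<close>

lemma inner_le_powr:
  fixes x y :: "'a::euclidean_space"
  assumes "1 < p" "p' = p / (p - 1)"
  shows "\<bar>y \<bullet> x\<bar> \<le> norm x powr p + norm y powr p'"
proof -
  define t where "t = norm y powr (1 / (p - 1))"
  have "t powr (p - 1) = norm y"
    using assms by (simp add: t_def powr_powr)
  moreover have "t powr p = norm y powr p'"
    using assms by (simp add: t_def powr_powr)
  ultimately have "p * (norm y * norm x) \<le> norm x powr p + (p - 1) * norm y powr p'"
    using powr_ge_tangent[of p "norm x" t] assms by (simp add: t_def mult.assoc)
  also have "\<dots> \<le> p * (norm x powr p + norm y powr p')"
  proof -
    have "1 * norm x powr p \<le> p * norm x powr p"
      using assms by (intro mult_right_mono) auto
    moreover have "0 \<le> norm y powr p'" by simp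
    ultimately show ?thesis by (simp only: algebra_simps)
  qed
  finally have "norm y * norm x \<le> norm x powr p + norm y powr p'"
    using assms by simp
  then show ?thesis
    using Cauchy_Schwarz_ineq2[of y x] by linarith
qed

lemma integrable_inner:
  fixes X Y :: "'b \<Rightarrow> 'a::euclidean_space"
  assumes p: "1 < p" "p' = p / (p - 1)"
    and [measurable]: "X \<in> borel_measurable M" "Y \<in> borel_measurable M"
    and "integrable M (\<lambda>\<omega>. norm (X \<omega>) powr p)" "integrable M (\<lambda>\<omega>. norm (Y \<omega>) powr p')"
  shows "integrable M (\<lambda>\<omega>. Y \<omega> \<bullet> X \<omega>)"
proof (rule Bochner_Integration.integrable_bound)
  show "integrable M (\<lambda>\<omega>. norm (X \<omega>) powr p + norm (Y \<omega>) powr p')"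
    using assms by simp
  show "AE \<omega> in M. norm (Y \<omega> \<bullet> X \<omega>) \<le> norm (norm (X \<omega>) powr p + norm (Y \<omega>) powr p')"
    using inner_le_powr[OF p] by (auto simp: add_nonneg_nonneg)
qed measurable

lemma norm_le_one_plus_powr: "1 \<le> p \<Longrightarrow> norm x \<le> 1 + norm x powr p"
proof (cases "norm x \<le> 1")
  case False
  assume "1 \<le> p"
  then have "norm x powr 1 \<le> norm x powr p"
    using False by (intro powr_mono) auto
  then show ?thesis using False by simp
qed (simp add: add_increasing2)

lemma (in prob_space) integrable_if_integrable_powr:
  fixes X :: "'a \<Rightarrow> 'b::euclidean_space"
  assumes "1 \<le> p" and [measurable]: "X \<in> borel_measurable M"
    and "integrable M (\<lambda>\<omega>. norm (X \<omega>) powr p)"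
  shows "integrable M X"
proof (rule Bochner_Integration.integrable_bound)
  show "integrable M (\<lambda>\<omega>. 1 + norm (X \<omega>) powr p)"
    using assms by simp
  show "AE \<omega> in M. norm (X \<omega>) \<le> norm (1 + norm (X \<omega>) powr p)"
    using norm_le_one_plus_powr[OF assms(1)] by (intro AE_I2) (simp add: add_nonneg_nonneg)
qed measurable

lemma norm_add_powr_le:
  fixes x y :: "'a::real_normed_vector"
  assumes "0 \<le> p"
  shows "norm (x + y) powr p \<le> 2 powr p * (norm x powr p + norm y powr p)"
proof -
  have "norm (x + y) \<le> 2 * max (norm x) (norm y)"
    using norm_triangle_ineq[of x y] by linarith
  then have "norm (x + y) powr p \<le> (2 * max (norm x) (norm y)) powr p"
    using assms by (intro powr_mono2) auto
  also have "\<dots> = 2 powr p * max (norm x) (norm y) powr p"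
    by (simp add: powr_mult)
  also have "\<dots> \<le> 2 powr p * (norm x powr p + norm y powr p)"
    by (intro mult_left_mono) (auto simp: max_def)
  finally show ?thesis .
qed

lemma norm_diff_powr_le:
  fixes x y :: "'a::real_normed_vector"
  assumes "0 \<le> p"
  shows "norm (x - y) powr p \<le> 2 powr p * (norm x powr p + norm y powr p)"
  using norm_add_powr_le[OF assms, of x "- y"] by simp

lemma integrable_norm_diff_powr:
  fixes X Z :: "'b \<Rightarrow> 'a::euclidean_space"
  assumes "0 \<le> p" and [measurable]: "X \<in> borel_measurable M" "Z \<in> borel_measurable M"
    and "integrable M (\<lambda>\<omega>. norm (X \<omega>) powr p)" "integrable M (\<lambda>\<omega>. norm (Z \<omega>) powr p)"
  shows "integrable M (\<lambda>\<omega>. norm (X \<omega> - Z \<omega>) powr p)"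
proof (rule Bochner_Integration.integrable_bound)
  show "integrable M (\<lambda>\<omega>. 2 powr p * (norm (X \<omega>) powr p + norm (Z \<omega>) powr p))"
    using assms by simp
  show "AE \<omega> in M. norm (norm (X \<omega> - Z \<omega>) powr p) \<le>
      norm (2 powr p * (norm (X \<omega>) powr p + norm (Z \<omega>) powr p))"
    by (intro AE_I2) (simp add: norm_diff_powr_le[OF assms(1)] order_trans[OF _ abs_ge_self])
qed measurable

section \<open>A variational principle for divergences\<close>

text \<open>
  The points are chosen one after the other: \<open>X\<^sub>k\<close> maximizes \<open>H - \<Sum>\<^sub>i\<^sub><\<^sub>k a\<^sub>i D(\<sqdot>, X\<^sub>i)\<close> up to \<open>a\<^sub>k / (k + 1)\<close>. If \<open>x\<close>
  maximizes the fully perturbed function \<open>\<Phi>\<close> up to \<open>\<eta>\<close>, then the term \<open>a\<^sub>k D(x, X\<^sub>k)\<close> can cost no more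
  than what \<open>X\<^sub>k\<close> loses: \<open>a\<^sub>k / (k + 1)\<close>, plus \<open>\<eta>\<close>, plus its later perturbations, which are at most
  \<open>B \<Sum>\<^sub>i\<^sub>>\<^sub>k a\<^sub>i\<close>. After division by \<open>a\<^sub>k\<close> this is small, provided that the weights decrease so fast that
  each dominates the sum of its successors. The conclusion speaks of almost maximizers instead of the
  supremum, so that it is insensitive to additive constants in \<open>H\<close>.
\<close>

lemma divergence_variational_principle:
  fixes D :: "'x \<Rightarrow> 'x \<Rightarrow> real" and H :: "'x \<Rightarrow> real" and a :: "nat \<Rightarrow> real"
  assumes "C \<noteq> {}" and bdd: "bdd_above (H ` C)"
    and D_nonneg: "\<And>x z. x \<in> C \<Longrightarrow> z \<in> C \<Longrightarrow> 0 \<le> D x z"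
    and D_le: "\<And>x z. x \<in> C \<Longrightarrow> z \<in> C \<Longrightarrow> D x z \<le> B"
    and D_self: "\<And>x. x \<in> C \<Longrightarrow> D x x = 0"
    and a_pos: "\<And>i. 0 < a i" and "summable a"
    and tail: "(\<lambda>k. (\<Sum>i. a (i + Suc k)) / a k) \<longlonglongrightarrow> 0"
  shows "\<exists>X. (\<forall>k. X k \<in> C) \<and>
    (\<forall>e>0. \<exists>k. \<exists>\<eta>>0. \<forall>x\<in>C.
       (\<forall>z\<in>C. H z - (\<Sum>i. a i * D z (X i)) - \<eta> \<le> H x - (\<Sum>i. a i * D x (X i)))
         \<longrightarrow> D x (X k) \<le> e)"
proof -
  define part where "part X k x = H x - (\<Sum>i<k. a i * D x (X i))" for X :: "nat \<Rightarrow> 'x" and k x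
  have "\<exists>X. \<forall>k. X k \<in> C \<and> (\<forall>z\<in>C. part X k z \<le> part X k (X k) + a k / (k + 1))"
  proof (rule dependent_wellorder_choice)
    fix r and X X' :: "nat \<Rightarrow> 'x" and k
    assume "\<And>i. i < k \<Longrightarrow> X i = X' i"
    then have "part X k = part X' k"
      by (auto simp: part_def fun_eq_iff)
    then show "(r \<in> C \<and> (\<forall>z\<in>C. part X k z \<le> part X k r + a k / (k + 1))) =
               (r \<in> C \<and> (\<forall>z\<in>C. part X' k z \<le> part X' k r + a k / (k + 1)))"
      by simp
  next
    fix k and X :: "nat \<Rightarrow> 'x"
    assume IH: "\<And>i. i < k \<Longrightarrow> X i \<in> C \<and> (\<forall>z\<in>C. part X i z \<le> part X i (X i) + a i / (i + 1))"
    obtain U where U: "\<And>x. x \<in> C \<Longrightarrow> H x \<le> U"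
      using bdd by (auto simp: bdd_above_def)
    have "part X k x \<le> U" if "x \<in> C" for x
    proof -
      have "0 \<le> (\<Sum>i<k. a i * D x (X i))"
        using IH that a_pos D_nonneg by (intro sum_nonneg mult_nonneg_nonneg) (auto intro: less_imp_le)
      then show ?thesis using U[OF that] by (simp add: part_def)
    qed
    then have b: "bdd_above (part X k ` C)"
      by (auto simp: bdd_above_def)
    have "(SUP x\<in>C. part X k x) - a k / (k + 1) < (SUP x\<in>C. part X k x)"
      using a_pos[of k] by simp
    then obtain r where "r \<in> C" "(SUP x\<in>C. part X k x) - a k / (k + 1) < part X k r"
      using less_cSUP_iff[OF \<open>C \<noteq> {}\<close> b] by blast
    then show "\<exists>r. r \<in> C \<and> (\<forall>z\<in>C. part X k z \<le> part X k r + a k / (k + 1))"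
      using cSUP_upper[OF _ b] by (intro exI[of _ r]) fastforce
  qed
  then obtain X where XC: "\<And>k. X k \<in> C"
    and Xmax: "\<And>k z. z \<in> C \<Longrightarrow> part X k z \<le> part X k (X k) + a k / (k + 1)"
    by blast
  define \<Phi> where "\<Phi> x = H x - (\<Sum>i. a i * D x (X i))" for x
  have summ: "summable (\<lambda>i. a i * D x (X i))" if "x \<in> C" for x
  proof (rule summable_comparison_test')
    show "summable (\<lambda>i. a i * B)"
      using \<open>summable a\<close> by (rule summable_mult2)
    show "norm (a i * D x (X i)) \<le> a i * B" for i
      using D_nonneg[OF that XC] D_le[OF that XC] a_pos[of i] by (simp add: abs_mult)
  qed
  have \<Phi>_split: "\<Phi> x = part X k x - (\<Sum>i. a (i + k) * D x (X (i + k)))" if "x \<in> C" for x k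
    using suminf_split_initial_segment[OF summ[OF that], of k] by (simp add: \<Phi>_def part_def)
  have tail_nonneg: "0 \<le> (\<Sum>i. a (i + k) * D x (X (i + k)))" if "x \<in> C" for x k
    using summable_ignore_initial_segment[OF summ[OF that], of k] D_nonneg[OF that XC] a_pos
    by (intro suminf_nonneg mult_nonneg_nonneg) (auto intro: less_imp_le)
  have key: "D x (X k) \<le> 1 / (real k + 1) + B * ((\<Sum>i. a (i + Suc k)) / a k) + \<eta> / a k"
    if "x \<in> C" "\<And>z. z \<in> C \<Longrightarrow> \<Phi> z - \<eta> \<le> \<Phi> x" for x k \<eta>
  proof -
    have "(\<Sum>i. a (i + k) * D (X k) (X (i + k))) \<le> B * (\<Sum>i. a (i + Suc k))"
    proof -
      have s: "summable (\<lambda>i. a (i + k) * D (X k) (X (i + k)))"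
        using summable_ignore_initial_segment[OF summ[OF XC], of k] .
      have "(\<Sum>i. a (i + k) * D (X k) (X (i + k))) = (\<Sum>i. a (i + Suc k) * D (X k) (X (i + Suc k)))"
        using suminf_split_head[OF s] D_self[OF XC] by simp
      also have "\<dots> \<le> (\<Sum>i. a (i + Suc k) * B)"
        using summable_ignore_initial_segment[OF summ[OF XC], of "Suc k"] D_le[OF XC XC] a_pos
          summable_mult2[OF summable_ignore_initial_segment[OF \<open>summable a\<close>, of "Suc k"]]
        by (intro suminf_le) (auto intro!: mult_left_mono less_imp_le)
      also have "\<dots> = B * (\<Sum>i. a (i + Suc k))"
        using suminf_mult2[OF summable_ignore_initial_segment[OF \<open>summable a\<close>, of "Suc k"]]
        by (simp add: mult.commute)
      finally show ?thesis .
    qed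
    then have "part X k (X k) \<le> \<Phi> (X k) + B * (\<Sum>i. a (i + Suc k))"
      using \<Phi>_split[OF XC, of k k] by simp
    also have "\<Phi> (X k) \<le> \<Phi> x + \<eta>"
      using that(2)[OF XC[of k]] by simp
    also have "\<Phi> x \<le> part X (Suc k) x"
      using \<Phi>_split[OF that(1), of "Suc k"] tail_nonneg[OF that(1), of "Suc k"] by linarith
    also have "part X (Suc k) x = part X k x - a k * D x (X k)"
      by (simp add: part_def)
    finally have "a k * D x (X k) \<le> a k / (k + 1) + B * (\<Sum>i. a (i + Suc k)) + \<eta>"
      using Xmax[OF that(1), of k] by linarith
    then have "(a k * D x (X k)) / a k \<le> (a k / (k + 1) + B * (\<Sum>i. a (i + Suc k)) + \<eta>) / a k"
      using a_pos[of k] by (intro divide_right_mono) auto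
    then show ?thesis
      using a_pos[of k] by (simp add: add_divide_distrib less_imp_neq[symmetric] add.commute)
  qed
  have "\<exists>k. \<exists>\<eta>>0. \<forall>x\<in>C. (\<forall>z\<in>C. \<Phi> z - \<eta> \<le> \<Phi> x) \<longrightarrow> D x (X k) \<le> e" if "e > 0" for e
  proof -
    have "(\<lambda>k. 1 / (real k + 1) + B * ((\<Sum>i. a (i + Suc k)) / a k)) \<longlonglongrightarrow> 0 + B * 0"
      using tail LIMSEQ_inverse_real_of_nat
      by (intro tendsto_add tendsto_mult_left) (simp_all add: inverse_eq_divide add.commute)
    then have "\<forall>\<^sub>F k in sequentially. 1 / (real k + 1) + B * ((\<Sum>i. a (i + Suc k)) / a k) < e / 2"
      using that by (intro order_tendstoD(2)) auto
    then obtain k where k: "1 / (real k + 1) + B * ((\<Sum>i. a (i + Suc k)) / a k) < e / 2"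
      using eventually_happens'[OF sequentially_bot] by blast
    have "\<forall>x\<in>C. (\<forall>z\<in>C. \<Phi> z - a k * (e / 2) \<le> \<Phi> x) \<longrightarrow> D x (X k) \<le> e"
    proof (intro ballI impI)
      fix x assume "x \<in> C" "\<forall>z\<in>C. \<Phi> z - a k * (e / 2) \<le> \<Phi> x"
      then have "D x (X k) \<le> 1 / (real k + 1) + B * ((\<Sum>i. a (i + Suc k)) / a k) + a k * (e / 2) / a k"
        by (intro key) auto
      then show "D x (X k) \<le> e"
        using k a_pos[of k] nonzero_mult_div_cancel_left[of "a k" "e / 2"] by linarith
    qed
    then show ?thesis
      using that a_pos[of k] by (intro exI[of _ k] exI[of _ "a k * (e / 2)"]) auto
  qed
  then show ?thesis
    using XC unfolding \<Phi>_def by blast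
qed

text \<open>
  The weights \<open>1 / i!\<close> decrease fast enough for the variational principle.
\<close>

lemma inverse_fact_tail_ratio_tendsto_0: "(\<lambda>k. (\<Sum>i. inverse (fact (i + Suc k))) / inverse (fact k :: real)) \<longlonglongrightarrow> 0"
proof (rule tendsto_sandwich[OF _ _ tendsto_const])
  have s: "summable (\<lambda>i. inverse (fact (i + Suc k)) :: real)" for k
    using summable_exp[of "1::real"] by (subst summable_iff_shift) simp
  have "(\<Sum>i. inverse (fact (i + Suc k))) / inverse (fact k :: real) \<le> 2 * inverse (real (Suc k))" for k
  proof -
    have "inverse (fact (i + Suc k)) \<le> (inverse (fact (Suc k)) :: real) * (1 / 2) ^ i" for i
    proof (induction i)
      case (Suc i)
      have "inverse (fact (Suc i + Suc k)) = inverse (real (i + k + 2)) * (inverse (fact (i + Suc k)) :: real)"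
        by (simp only: add_Suc fact_Suc inverse_mult_distrib) (simp add: add.commute)
      also have "\<dots> \<le> (1 / 2) * (inverse (fact (Suc k)) * (1 / 2) ^ i)"
        using Suc.IH by (intro mult_mono) (auto simp: field_simps)
      finally show ?case by simp
    qed simp
    then have "(\<Sum>i. inverse (fact (i + Suc k))) \<le> (\<Sum>i. (inverse (fact (Suc k)) :: real) * (1 / 2) ^ i)"
      by (intro suminf_le s summable_mult summable_geometric) auto
    also have "\<dots> = inverse (fact (Suc k)) * 2"
      by (subst suminf_mult) (auto simp: suminf_geometric intro: summable_geometric)
    finally have "(\<Sum>i. inverse (fact (i + Suc k))) * fact k \<le> inverse (fact (Suc k)) * 2 * (fact k :: real)"
      by (rule mult_right_mono) simp
    also have "\<dots> = 2 * inverse (real (Suc k))"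
      by (simp only: fact_Suc inverse_mult_distrib of_nat_mult) simp
    finally show ?thesis by (simp add: divide_inverse)
  qed
  then show "\<forall>\<^sub>F k in sequentially. (\<Sum>i. inverse (fact (i + Suc k))) / inverse (fact k :: real)
      \<le> 2 * inverse (real (Suc k))" by simp
  show "(\<lambda>k. 2 * inverse (real (Suc k))) \<longlonglongrightarrow> 0"
    using tendsto_mult_left[OF LIMSEQ_inverse_real_of_nat, of 2] by simp
  show "\<forall>\<^sub>F k in sequentially. 0 \<le> (\<Sum>i. inverse (fact (i + Suc k))) / inverse (fact k :: real)"
    using s by (intro always_eventually allI divide_nonneg_nonneg suminf_nonneg) auto
qed

section \<open>A probability space with room for every law\<close>

text \<open>
  The real number in an index only makes copies: every law occurs uncountably often. Measures that are
  not laws on the space are replaced by a point mass, so that every index can be used in the product.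
\<close>

definition coordinate_law :: "'a::euclidean_space measure \<times> real \<Rightarrow> 'a measure" where
  "coordinate_law i =
     (if prob_space (fst i) \<and> sets (fst i) = sets borel then fst i else return borel 0)"

definition universal_space :: "('a::euclidean_space measure \<times> real \<Rightarrow> 'a) measure" where
  "universal_space = PiM UNIV coordinate_law"

lemma prob_space_coordinate_law: "prob_space (coordinate_law i)"
  by (auto simp: coordinate_law_def prob_space_return)

lemma sets_coordinate_law [simp, measurable_cong]: "sets (coordinate_law i) = sets borel"
  by (simp add: coordinate_law_def)

lemma space_coordinate_law [simp]: "space (coordinate_law i) = UNIV"
  using sets_eq_imp_space_eq[OF sets_coordinate_law] by simp

interpretation coordinate_laws: product_prob_space "coordinate_law" UNIV
  by (intro product_prob_spaceI prob_space_coordinate_law)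

lemma prob_space_universal_space: "prob_space universal_space"
  unfolding universal_space_def by (rule prob_space_PiM) (rule prob_space_coordinate_law)

interpretation universal: prob_space universal_space
  by (rule prob_space_universal_space)

lemma space_universal_space [simp]: "space universal_space = UNIV"
  by (simp add: universal_space_def space_PiM)

lemma measurable_coordinate [measurable]:
  "(\<lambda>\<omega>. \<omega> i) \<in> borel_measurable universal_space"
  using measurable_component_singleton[of i UNIV coordinate_law]
  by (simp add: universal_space_def cong: measurable_cong_sets)

text \<open>
  A cylinder involves finitely many coordinates and is independent of the others. Complements keep the
  exceptional set, and countable disjoint unions take the union of countably many countable sets, so
  the property extends to the generated sigma-algebra.
\<close>

lemma event_indep_of_cocountably_many_coordinates:
  assumes "A \<in> sets (universal_space :: ('a::euclidean_space measure \<times> real \<Rightarrow> 'a) measure)"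
  shows "\<exists>J. countable J \<and> (\<forall>i. i \<notin> J \<longrightarrow> (\<forall>S\<in>sets borel.
           emeasure universal_space (A \<inter> {\<omega>. \<omega> i \<in> S}) =
           emeasure universal_space A * emeasure (coordinate_law i) S))"
proof -
  let ?L = "coordinate_law :: 'a measure \<times> real \<Rightarrow> 'a measure"
  let ?U = "universal_space :: ('a measure \<times> real \<Rightarrow> 'a) measure"
  let ?P = "\<lambda>A J. countable J \<and> (\<forall>i. i \<notin> J \<longrightarrow> (\<forall>S\<in>sets borel.
           emeasure ?U (A \<inter> {\<omega>. \<omega> i \<in> S}) = emeasure ?U A * emeasure (?L i) S))"
  have cyl: "{\<omega>. \<omega> i \<in> S} \<in> sets ?U" if "S \<in> sets borel" for i S
    using measurable_sets[OF measurable_coordinate[of i] that] by (simp add: vimage_def)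
  have cyl_measure: "emeasure ?U {\<omega>. \<omega> i \<in> S} = emeasure (?L i) S" if "S \<in> sets borel" for i S
    using coordinate_laws.emeasure_PiM_Collect_single[of i S] that
    by (simp add: universal_space_def space_PiM)
  have sets_U: "sets ?U = sigma_sets (\<Pi>\<^sub>E i\<in>UNIV. space (?L i)) (prod_algebra UNIV ?L)"
    by (simp add: universal_space_def sets_PiM)
  have "A \<in> sigma_sets (\<Pi>\<^sub>E i\<in>UNIV. space (?L i)) (prod_algebra UNIV ?L)"
    using assms sets_U by simp
  with Int_stable_prod_algebra prod_algebra_sets_into_space show "\<exists>J. ?P A J"
  proof (induction rule: sigma_sets_induct_disjoint)
    case (basic A)
    then obtain J E where A: "A = prod_emb UNIV ?L J (\<Pi>\<^sub>E j\<in>J. E j)" "finite J"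
      and E: "\<And>j. j \<in> J \<Longrightarrow> E j \<in> sets (?L j)"
      by (elim prod_algebraE) auto
    have A_Collect: "A = {\<omega>. \<forall>j\<in>J. \<omega> j \<in> E j}"
      by (auto simp: A prod_emb_def PiE_iff)
    have "emeasure ?U (A \<inter> {\<omega>. \<omega> i \<in> S}) = emeasure ?U A * emeasure (?L i) S"
      if "i \<notin> J" "S \<in> sets borel" for i S
    proof -
      define F where "F = E(i := S)"
      have F: "F j \<in> sets (?L j)" if "j \<in> insert i J" for j
        using that E[of j] \<open>S \<in> sets borel\<close> by (cases "j = i") (simp_all add: F_def)
      have "A \<inter> {\<omega>. \<omega> i \<in> S} = {\<omega>. \<forall>j\<in>insert i J. \<omega> j \<in> F j}"
        using that by (auto simp: A_Collect F_def)
      moreover have "emeasure ?U {\<omega>. \<forall>j\<in>insert i J. \<omega> j \<in> F j} = (\<Prod>j\<in>insert i J. emeasure (?L j) (F j))"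
        using coordinate_laws.emeasure_PiM_Collect[of "insert i J" F, OF subset_UNIV _ F] A(2)
        by (simp add: universal_space_def space_PiM)
      moreover have "emeasure ?U A = (\<Prod>j\<in>J. emeasure (?L j) (E j))"
        using coordinate_laws.emeasure_PiM_Collect[OF subset_UNIV A(2) E]
        by (simp add: universal_space_def space_PiM A_Collect)
      moreover have "(\<Prod>j\<in>J. emeasure (?L j) (F j)) = (\<Prod>j\<in>J. emeasure (?L j) (E j))"
        using that by (intro prod.cong) (auto simp: F_def)
      moreover have "F i = S"
        by (simp add: F_def)
      ultimately show ?thesis
        using that A(2) by (simp add: mult.commute)
    qed
    then show ?case
      using A(2) by (intro exI[of _ J]) (auto intro: countable_finite)
  next
    case empty
    show ?case by (intro exI[of _ "{}"]) simp
  next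
    case (compl A)
    then obtain J where J: "?P A J" by blast
    have A: "A \<in> sets ?U" using compl sets_U by simp
    have "emeasure ?U ((UNIV - A) \<inter> {\<omega>. \<omega> i \<in> S}) = emeasure ?U (UNIV - A) * emeasure (?L i) S"
      if "i \<notin> J" "S \<in> sets borel" for i S
    proof -
      let ?S = "{\<omega>. \<omega> i \<in> S}"
      have "A \<inter> ?S \<in> sets ?U" "(UNIV - A) \<inter> ?S \<in> sets ?U" "UNIV - A \<in> sets ?U"
        using A cyl[OF that(2)] sets.compl_sets[OF A] by auto
      then have split: "emeasure ?U (A \<inter> ?S) + emeasure ?U ((UNIV - A) \<inter> ?S) = emeasure ?U ?S"
        and total: "emeasure ?U A + emeasure ?U (UNIV - A) = 1"
        using A universal.emeasure_space_1
        by (subst plus_emeasure; auto intro!: arg_cong[of _ _ "emeasure ?U"])+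
      have A_S: "emeasure ?U (A \<inter> ?S) = emeasure ?U A * emeasure (?L i) S"
        using J that by blast
      have "emeasure ?U A * emeasure (?L i) S + emeasure ?U ((UNIV - A) \<inter> ?S) = 1 * emeasure (?L i) S"
        using split A_S cyl_measure[OF that(2), of i] by simp
      also have "\<dots> = emeasure ?U A * emeasure (?L i) S + emeasure ?U (UNIV - A) * emeasure (?L i) S"
        by (simp only: total[symmetric] distrib_right)
      finally show ?thesis
        using universal.emeasure_finite[of "A \<inter> ?S"]
        by (simp only: A_S ennreal_add_left_cancel infinity_ennreal_def) simp
    qed
    then show ?case
      using J by (intro exI[of _ J]) (simp add: PiE_UNIV_domain del: split_paired_All)
  next
    case (union A)
    then obtain J where J: "\<And>n. ?P (A n) (J n)" by metis
    have A: "range A \<subseteq> sets ?U" using union sets_U by simp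
    have "emeasure ?U ((\<Union>n. A n) \<inter> {\<omega>. \<omega> i \<in> S}) = emeasure ?U (\<Union>n. A n) * emeasure (?L i) S"
      if "i \<notin> (\<Union>n. J n)" "S \<in> sets borel" for i S
    proof -
      have "emeasure ?U ((\<Union>n. A n) \<inter> {\<omega>. \<omega> i \<in> S}) = emeasure ?U (\<Union>n. A n \<inter> {\<omega>. \<omega> i \<in> S})"
        by (simp add: Int_UN_distrib2)
      also have "\<dots> = (\<Sum>n. emeasure ?U (A n \<inter> {\<omega>. \<omega> i \<in> S}))"
      proof (rule suminf_emeasure[symmetric])
        show "disjoint_family (\<lambda>n. A n \<inter> {\<omega>. \<omega> i \<in> S})"
          using union(1) by (rule disjoint_family_subset) auto
        show "range (\<lambda>n. A n \<inter> {\<omega>. \<omega> i \<in> S}) \<subseteq> sets ?U"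
          using A cyl[OF that(2)] by (intro image_subsetI sets.Int) auto
      qed
      also have "\<dots> = (\<Sum>n. emeasure ?U (A n) * emeasure (?L i) S)"
        using J that by (intro suminf_cong) blast
      also have "\<dots> = (\<Sum>n. emeasure ?U (A n)) * emeasure (?L i) S"
        by simp
      also have "(\<Sum>n. emeasure ?U (A n)) = emeasure ?U (\<Union>n. A n)"
        using A union(1) by (intro suminf_emeasure) auto
      finally show ?thesis .
    qed
    then show ?case
      using J by (intro exI[of _ "\<Union>n. J n"] conjI allI impI ballI countable_UN) blast+
  qed
qed

text \<open>
  On each cell a coordinate with the prescribed law is used that is independent of the cell. Such a
  coordinate exists because only countably many of the uncountably many copies are excluded.
\<close>

lemma exists_with_conditional_laws:
  fixes cell :: "('a::euclidean_space measure \<times> real \<Rightarrow> 'a) \<Rightarrow> nat" and \<nu> :: "nat \<Rightarrow> 'a measure"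
  assumes cell: "cell \<in> measurable universal_space (count_space UNIV)"
    and \<nu>: "\<And>n. prob_space (\<nu> n)" "\<And>n. sets (\<nu> n) = sets borel"
  shows "\<exists>X\<in>borel_measurable universal_space. \<forall>n. \<forall>S\<in>sets borel.
           emeasure universal_space {\<omega>. cell \<omega> = n \<and> X \<omega> \<in> S} =
           emeasure universal_space {\<omega>. cell \<omega> = n} * emeasure (\<nu> n) S"
proof -
  let ?U = "universal_space :: ('a measure \<times> real \<Rightarrow> 'a) measure"
  let ?A = "\<lambda>n. {\<omega>. cell \<omega> = n}"
  have A: "?A n \<in> sets ?U" for n
    using measurable_sets[OF cell, of "{n}"] by (simp add: vimage_def)
  obtain J where J: "\<And>n. countable (J n)"
    "\<And>n i S. i \<notin> J n \<Longrightarrow> S \<in> sets borel \<Longrightarrow>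
       emeasure ?U (?A n \<inter> {\<omega>. \<omega> i \<in> S}) = emeasure ?U (?A n) * emeasure (coordinate_law i) S"
    using event_indep_of_cocountably_many_coordinates[OF A] by metis
  have "\<exists>r. (\<nu> n, r) \<notin> J n" for n
  proof (rule ccontr)
    assume "\<nexists>r. (\<nu> n, r) \<notin> J n"
    then have "range (\<lambda>r::real. (\<nu> n, r)) \<subseteq> J n" by auto
    then have "countable (range (\<lambda>r::real. (\<nu> n, r)))"
      using J(1) countable_subset by blast
    then have "countable (UNIV :: real set)"
      by (rule countable_image_inj_on) (auto simp: inj_on_def)
    then show False using uncountable_UNIV_real by simp
  qed
  then obtain r where r: "\<And>n. (\<nu> n, r n) \<notin> J n" by metis
  define X where "X \<omega> = \<omega> (\<nu> (cell \<omega>), r (cell \<omega>))" for \<omega>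
  have "X \<in> borel_measurable ?U"
    unfolding X_def
    by (rule measurable_compose_countable[OF _ cell, of "\<lambda>n \<omega>. \<omega> (\<nu> n, r n)"])
       (rule measurable_coordinate)
  moreover have "emeasure ?U {\<omega>. cell \<omega> = n \<and> X \<omega> \<in> S} = emeasure ?U (?A n) * emeasure (\<nu> n) S"
    if "S \<in> sets borel" for n S
  proof -
    have "{\<omega>. cell \<omega> = n \<and> X \<omega> \<in> S} = ?A n \<inter> {\<omega>. \<omega> (\<nu> n, r n) \<in> S}"
      by (auto simp: X_def)
    then show ?thesis
      using J(2)[OF r that, of n] \<nu> by (simp add: coordinate_law_def)
  qed
  ultimately show ?thesis by blast
qed

text \<open>
  The conditional laws of \<open>Z\<close> given \<open>c\<close> are the data for the preceding lemma. Since \<open>c\<close> is discrete,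
  they are elementary conditional probabilities; the law is arbitrary on cells of probability zero.
\<close>

lemma exists_with_joint_cell_law:
  fixes cell :: "('a::euclidean_space measure \<times> real \<Rightarrow> 'a) \<Rightarrow> nat" and c :: "'b \<Rightarrow> nat" and Z :: "'b \<Rightarrow> 'a"
  assumes cell: "cell \<in> measurable universal_space (count_space UNIV)"
    and "prob_space N"
    and [measurable]: "c \<in> measurable N (count_space UNIV)" "Z \<in> borel_measurable N"
    and same: "distr universal_space (count_space UNIV) cell = distr N (count_space UNIV) c"
  shows "\<exists>X\<in>borel_measurable universal_space.
           distr universal_space (count_space UNIV \<Otimes>\<^sub>M borel) (\<lambda>\<omega>. (cell \<omega>, X \<omega>)) =
           distr N (count_space UNIV \<Otimes>\<^sub>M borel) (\<lambda>\<omega>. (c \<omega>, Z \<omega>))"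
proof -
  let ?U = "universal_space :: ('a measure \<times> real \<Rightarrow> 'a) measure"
  let ?B = "\<lambda>n. {\<omega>\<in>space N. c \<omega> = n}"
  interpret N: prob_space N by fact
  define \<nu> where "\<nu> n = (if emeasure N (?B n) = 0 then return borel 0
      else distr (uniform_measure N (?B n)) borel Z)" for n
  have sets_\<nu>: "sets (\<nu> n) = sets borel" for n
    by (simp add: \<nu>_def)
  have prob_\<nu>: "prob_space (\<nu> n)" for n
  proof -
    have "prob_space (distr (uniform_measure N (?B n)) borel Z)" if "emeasure N (?B n) \<noteq> 0"
      using that by (intro prob_space.prob_space_distr prob_space_uniform_measure)
        (auto simp: N.emeasure_finite)
    then show ?thesis by (auto simp: \<nu>_def prob_space_return)
  qed
  obtain X where [measurable]: "X \<in> borel_measurable ?U"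
    and "\<forall>n. \<forall>S\<in>sets borel. emeasure ?U {\<omega>. cell \<omega> = n \<and> X \<omega> \<in> S} =
           emeasure ?U {\<omega>. cell \<omega> = n} * emeasure (\<nu> n) S"
    using exists_with_conditional_laws[OF cell prob_\<nu> sets_\<nu>] ..
  then have X: "emeasure ?U {\<omega>. cell \<omega> = n \<and> X \<omega> \<in> S} =
      emeasure ?U {\<omega>. cell \<omega> = n} * emeasure (\<nu> n) S" if "S \<in> sets borel" for n S
    using that by simp
  have cells: "emeasure ?U {\<omega>. cell \<omega> = n} = emeasure N (?B n)" for n
    using arg_cong[OF same, of "\<lambda>M. emeasure M {n}"] cell
    by (simp add: emeasure_distr vimage_def Int_def conj_commute)
  have cond: "emeasure N (?B n) * emeasure (\<nu> n) S = emeasure N {\<omega>\<in>space N. c \<omega> = n \<and> Z \<omega> \<in> S}"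
    if [measurable]: "S \<in> sets borel" for n S
  proof (cases "emeasure N (?B n) = 0")
    case True
    have "emeasure N {\<omega>\<in>space N. c \<omega> = n \<and> Z \<omega> \<in> S} \<le> emeasure N (?B n)"
      by (intro emeasure_mono) auto
    then show ?thesis using True by simp
  next
    case False
    have "emeasure (\<nu> n) S = emeasure N (?B n \<inter> (Z -` S \<inter> space N)) / emeasure N (?B n)"
      using False by (simp add: \<nu>_def emeasure_distr)
    also have "?B n \<inter> (Z -` S \<inter> space N) = {\<omega>\<in>space N. c \<omega> = n \<and> Z \<omega> \<in> S}"
      by auto
    finally show ?thesis
      using False N.emeasure_finite by (simp add: ennreal_times_divide ennreal_mult_divide_eq mult.commute[of "emeasure N (?B n)"])
  qed
  have "distr ?U (count_space UNIV \<Otimes>\<^sub>M borel) (\<lambda>\<omega>. (cell \<omega>, X \<omega>)) =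
        distr N (count_space UNIV \<Otimes>\<^sub>M borel) (\<lambda>\<omega>. (c \<omega>, Z \<omega>))" (is "?l = ?r")
  proof (rule measure_eqI)
    fix T assume "T \<in> sets ?l"
    then have T [measurable]: "T \<in> sets (count_space UNIV \<Otimes>\<^sub>M (borel :: 'a measure))" by simp
    have section_T [measurable]: "{y. (n, y) \<in> T} \<in> sets borel" for n
      using sets_Pair1[OF T, of n] by (simp add: vimage_def)
    note [measurable] = cell
    have "emeasure ?l T = emeasure ?U {\<omega>. (cell \<omega>, X \<omega>) \<in> T}"
      by (simp add: emeasure_distr vimage_def)
    also have "{\<omega>. (cell \<omega>, X \<omega>) \<in> T} = (\<Union>n. {\<omega>. cell \<omega> = n \<and> X \<omega> \<in> {y. (n, y) \<in> T}})"
      by auto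
    also have "emeasure ?U \<dots> = (\<Sum>n. emeasure ?U {\<omega>. cell \<omega> = n \<and> X \<omega> \<in> {y. (n, y) \<in> T}})"
    proof (rule suminf_emeasure[symmetric])
      have "{\<omega>\<in>space ?U. cell \<omega> = n \<and> X \<omega> \<in> {y. (n, y) \<in> T}} \<in> sets ?U" for n
        by measurable
      then show "range (\<lambda>n. {\<omega>. cell \<omega> = n \<and> X \<omega> \<in> {y. (n, y) \<in> T}}) \<subseteq> sets ?U"
        by auto
    qed (auto simp: disjoint_family_on_def)
    also have "\<dots> = (\<Sum>n. emeasure N {\<omega>\<in>space N. c \<omega> = n \<and> Z \<omega> \<in> {y. (n, y) \<in> T}})"
      by (simp only: X[OF section_T] cells cond[OF section_T])
    also have "\<dots> = emeasure N (\<Union>n. {\<omega>\<in>space N. c \<omega> = n \<and> Z \<omega> \<in> {y. (n, y) \<in> T}})"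
      by (rule suminf_emeasure) (auto simp: disjoint_family_on_def)
    also have "(\<Union>n. {\<omega>\<in>space N. c \<omega> = n \<and> Z \<omega> \<in> {y. (n, y) \<in> T}}) = (\<lambda>\<omega>. (c \<omega>, Z \<omega>)) -` T \<inter> space N"
      by auto
    also have "emeasure N \<dots> = emeasure ?r T"
      by (simp add: emeasure_distr)
    finally show "emeasure ?l T = emeasure ?r T" .
  qed simp
  then show ?thesis by (intro bexI[of _ X]) auto
qed

lemma law_realized:
  fixes \<nu> :: "'a::euclidean_space measure"
  assumes "prob_space \<nu>" "sets \<nu> = sets borel"
  shows "distr universal_space borel (\<lambda>\<omega>. \<omega> (\<nu>, r)) = \<nu>"
proof -
  have "distr universal_space (coordinate_law (\<nu>, r)) (\<lambda>\<omega>. \<omega> (\<nu>, r)) = coordinate_law (\<nu>, r)"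
    unfolding universal_space_def by (rule coordinate_laws.PiM_component) simp
  moreover have "coordinate_law (\<nu>, r) = \<nu>"
    using assms by (simp add: coordinate_law_def)
  ultimately show ?thesis
    using assms(2) distr_cong[of universal_space universal_space borel \<nu> "\<lambda>\<omega>. \<omega> (\<nu>, r)" "\<lambda>\<omega>. \<omega> (\<nu>, r)"]
    by simp
qed

section \<open>Couplings, Wasserstein distance and correlation cost\<close>

lemma couplingsD:
  assumes "\<gamma> \<in> couplings \<mu> \<nu>"
  shows "prob_space \<gamma>" "sets \<gamma> = sets borel" "distr \<gamma> borel fst = \<mu>" "distr \<gamma> borel snd = \<nu>"
  using assms by (auto simp: couplings_def)

lemma coupling_measurable:
  assumes "\<gamma> \<in> couplings \<mu> \<nu>"
  shows "fst \<in> borel_measurable \<gamma>" "snd \<in> borel_measurable \<gamma>"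
proof -
  have "sets \<gamma> = sets (borel \<Otimes>\<^sub>M borel)"
    using couplingsD(2)[OF assms] unfolding borel_prod .
  then show "fst \<in> borel_measurable \<gamma>" "snd \<in> borel_measurable \<gamma>"
    by (simp_all cong: measurable_cong_sets)
qed

lemma coupling_integrable:
  fixes h :: "'a::euclidean_space \<Rightarrow> real"
  assumes "\<gamma> \<in> couplings \<mu> \<nu>" and [measurable]: "h \<in> borel_measurable borel"
  shows "integrable \<mu> h \<Longrightarrow> integrable \<gamma> (\<lambda>z. h (fst z))"
    "integrable \<nu> h \<Longrightarrow> integrable \<gamma> (\<lambda>z. h (snd z))"
    "(\<integral>z. h (fst z) \<partial>\<gamma>) = (\<integral>x. h x \<partial>\<mu>)" "(\<integral>z. h (snd z) \<partial>\<gamma>) = (\<integral>x. h x \<partial>\<nu>)"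
  using coupling_measurable[OF assms(1)] couplingsD(3,4)[OF assms(1)]
  by (auto simp: integrable_distr_eq integral_distr)

lemma borel_measurable_norm_powr [measurable]: "(\<lambda>x::'a::euclidean_space. norm x powr p) \<in> borel_measurable borel"
  by measurable

lemma coupling_integrable_inner:
  assumes p: "1 < p" "p' = p / (p - 1)"
    and \<gamma>: "\<gamma> \<in> couplings \<xi> \<nu>"
    and "integrable \<xi> (\<lambda>x. norm x powr p')" "integrable \<nu> (\<lambda>x. norm x powr p)"
  shows "integrable \<gamma> (\<lambda>z. fst z \<bullet> snd z)"
  using coupling_measurable[OF \<gamma>]
    coupling_integrable(2)[OF \<gamma> borel_measurable_norm_powr assms(5)]
    coupling_integrable(1)[OF \<gamma> borel_measurable_norm_powr assms(4)]
  by (intro integrable_inner[OF p])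

lemma joint_law_coupling:
  fixes X Z :: "'b \<Rightarrow> 'a::euclidean_space"
  assumes "prob_space M" and [measurable]: "X \<in> borel_measurable M" "Z \<in> borel_measurable M"
  shows "distr M borel (\<lambda>\<omega>. (X \<omega>, Z \<omega>)) \<in> couplings (distr M borel X) (distr M borel Z)"
proof -
  have pair [measurable]: "(\<lambda>\<omega>. (X \<omega>, Z \<omega>)) \<in> borel_measurable M"
    by (rule borel_measurable_Pair) measurable
  have "prob_space (distr M borel (\<lambda>\<omega>. (X \<omega>, Z \<omega>)))"
    using assms(1) pair by (rule prob_space.prob_space_distr)
  moreover have "fst \<in> borel_measurable (borel :: ('a \<times> 'a) measure)"
    "snd \<in> borel_measurable (borel :: ('a \<times> 'a) measure)"
    by (intro borel_measurable_continuous_onI continuous_intros)+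
  ultimately show ?thesis
    using pair by (simp add: couplings_def distr_distr comp_def)
qed

lemma integral_joint_law:
  fixes X Z :: "'b \<Rightarrow> 'a::euclidean_space" and h :: "'a \<times> 'a \<Rightarrow> real"
  assumes [measurable]: "X \<in> borel_measurable M" "Z \<in> borel_measurable M" "h \<in> borel_measurable borel"
  shows "(\<integral>z. h z \<partial>distr M borel (\<lambda>\<omega>. (X \<omega>, Z \<omega>))) = (\<integral>\<omega>. h (X \<omega>, Z \<omega>) \<partial>M)"
  by (rule integral_distr) (auto intro: borel_measurable_Pair)

lemma couplings_nonempty:
  fixes \<mu> \<nu> :: "'a::euclidean_space measure"
  assumes "prob_space \<mu>" "sets \<mu> = sets borel" "prob_space \<nu>" "sets \<nu> = sets borel"
  shows "couplings \<mu> \<nu> \<noteq> {}"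
  using joint_law_coupling[OF prob_space_universal_space measurable_coordinate measurable_coordinate,
      of "(\<mu>, 0)" "(\<nu>, 0)"] law_realized[OF assms(1,2)] law_realized[OF assms(3,4)]
  by auto

text \<open>
  The joint law is one of the couplings over which the infimum is taken.
\<close>

lemma wasserstein_laws_le:
  fixes X Z :: "'b \<Rightarrow> 'a::euclidean_space"
  assumes "1 < p" "prob_space M" and [measurable]: "X \<in> borel_measurable M" "Z \<in> borel_measurable M"
  shows "wasserstein p (distr M borel X) (distr M borel Z) \<le> (\<integral>\<omega>. norm (X \<omega> - Z \<omega>) powr p \<partial>M) powr (1 / p)"
proof -
  let ?I = "\<lambda>\<gamma> :: ('a \<times> 'a) measure. \<integral>z. dist (fst z) (snd z) powr p \<partial>\<gamma>"
  let ?C = "couplings (distr M borel X) (distr M borel Z)"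
  note mem = joint_law_coupling[OF assms(2-4)]
  have "(\<lambda>z::'a \<times> 'a. dist (fst z) (snd z) powr p) \<in> borel_measurable borel"
    by (intro powr_real_measurable borel_measurable_continuous_onI continuous_intros measurable_const)
  then have "?I (distr M borel (\<lambda>\<omega>. (X \<omega>, Z \<omega>))) = (\<integral>\<omega>. norm (X \<omega> - Z \<omega>) powr p \<partial>M)"
    by (subst integral_joint_law) (auto simp: dist_norm)
  moreover have "(INF \<gamma>\<in>?C. ?I \<gamma>) \<le> ?I (distr M borel (\<lambda>\<omega>. (X \<omega>, Z \<omega>)))"
    by (intro cINF_lower mem bdd_belowI2[of _ 0]) auto
  moreover have "0 \<le> (INF \<gamma>\<in>?C. ?I \<gamma>)"
    using mem by (intro cINF_greatest) auto
  ultimately show ?thesis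
    using assms(1) by (auto simp: wasserstein_def intro!: powr_mono2)
qed

text \<open>
  Some coupling has cost at most \<open>C\<^sup>p + 1\<close>; along it, \<open>|y|\<^sup>p \<le> 2\<^sup>p (|x|\<^sup>p + |y - x|\<^sup>p)\<close>. The summand \<open>1\<close>
  accounts for the infimum not being attained a priori.
\<close>

lemma moment_le_if_wasserstein_le:
  assumes "1 < p" and \<mu>: "\<mu> \<in> finite_moment_measures p" and \<nu>: "\<nu> \<in> finite_moment_measures p"
    and "wasserstein p \<mu> \<nu> \<le> C"
  shows "moment p \<nu> \<le> 2 powr p * (moment p \<mu> + (C powr p + 1))"
proof -
  let ?I = "\<lambda>\<gamma> :: ('a \<times> 'a) measure. \<integral>z. dist (fst z) (snd z) powr p \<partial>\<gamma>"
  define w where "w = (INF \<gamma>\<in>couplings \<mu> \<nu>. ?I \<gamma>)"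
  have ne: "couplings \<mu> \<nu> \<noteq> {}"
    using \<mu> \<nu> by (intro couplings_nonempty) (auto simp: finite_moment_measures_def)
  have "0 \<le> w"
    unfolding w_def using ne by (intro cINF_greatest) auto
  have "w = (w powr (1 / p)) powr p"
    using \<open>0 \<le> w\<close> assms(1) by (simp add: powr_powr)
  also have "\<dots> \<le> C powr p"
    using assms(1,4) by (intro powr_mono2) (auto simp: wasserstein_def w_def)
  finally have "w < C powr p + 1" by simp
  then obtain \<gamma> where \<gamma>: "\<gamma> \<in> couplings \<mu> \<nu>" and I: "?I \<gamma> < C powr p + 1"
    using ne cINF_less_iff[OF ne bdd_belowI2[of _ 0 ?I]] by (auto simp: w_def)
  note [measurable] = coupling_measurable[OF \<gamma>]
  have int: "integrable \<gamma> (\<lambda>z. norm (fst z) powr p)" "integrable \<gamma> (\<lambda>z. norm (snd z) powr p)"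
    using coupling_integrable[OF \<gamma> borel_measurable_norm_powr, of p] \<mu> \<nu>
    by (auto simp: finite_moment_measures_def)
  then have int_d: "integrable \<gamma> (\<lambda>z. norm (snd z - fst z) powr p)"
    using assms(1) by (intro integrable_norm_diff_powr) auto
  have "moment p \<nu> = (\<integral>z. norm (snd z) powr p \<partial>\<gamma>)"
    using coupling_integrable(4)[OF \<gamma> borel_measurable_norm_powr, of p] by (simp add: moment_def)
  also have "\<dots> \<le> (\<integral>z. 2 powr p * (norm (fst z) powr p + norm (snd z - fst z) powr p) \<partial>\<gamma>)"
  proof (rule integral_mono)
    show "integrable \<gamma> (\<lambda>z. 2 powr p * (norm (fst z) powr p + norm (snd z - fst z) powr p))"
      using int int_d by simp
    show "norm (snd z) powr p \<le> 2 powr p * (norm (fst z) powr p + norm (snd z - fst z) powr p)" for z :: "'a \<times> 'a"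
      using norm_add_powr_le[of p "fst z" "snd z - fst z"] assms(1) by simp
  qed (rule int)
  also have "\<dots> = 2 powr p * (moment p \<mu> + ?I \<gamma>)"
    using int int_d coupling_integrable(3)[OF \<gamma> borel_measurable_norm_powr, of p]
    by (simp add: moment_def dist_norm norm_minus_commute)
  also have "\<dots> \<le> 2 powr p * (moment p \<mu> + (C powr p + 1))"
    using I by (intro mult_left_mono) auto
  finally show ?thesis .
qed

text \<open>
  Again the joint law is a coupling. Young's inequality shows that the infimum is taken over a set that
  is bounded below.
\<close>

lemma correlation_cost_le:
  fixes X Y :: "'b \<Rightarrow> 'a::euclidean_space"
  assumes p: "1 < p" "p' = p / (p - 1)" and "prob_space M"
    and [measurable]: "X \<in> borel_measurable M" "Y \<in> borel_measurable M"
    and X: "integrable M (\<lambda>\<omega>. norm (X \<omega>) powr p)" and Y: "integrable M (\<lambda>\<omega>. norm (Y \<omega>) powr p')"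
  shows "(\<integral>\<omega>. Y \<omega> \<bullet> X \<omega> \<partial>M) \<le> - correlation_cost (distr M borel Y) (distr M borel X)"
proof -
  let ?\<xi> = "distr M borel Y" and ?\<nu> = "distr M borel X"
  have X': "integrable ?\<nu> (\<lambda>x. norm x powr p)" and Y': "integrable ?\<xi> (\<lambda>x. norm x powr p')"
    using X Y by (simp_all add: integrable_distr_eq)
  have "(\<integral>z. fst z \<bullet> snd z \<partial>\<gamma>) \<le> moment p ?\<nu> + moment p' ?\<xi>" if \<gamma>: "\<gamma> \<in> couplings ?\<xi> ?\<nu>" for \<gamma>
  proof -
    have "(\<integral>z. fst z \<bullet> snd z \<partial>\<gamma>) \<le> (\<integral>z. norm (snd z) powr p + norm (fst z) powr p' \<partial>\<gamma>)"
    proof (rule integral_mono)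
      show "integrable \<gamma> (\<lambda>z. norm (snd z) powr p + norm (fst z) powr p')"
        using coupling_integrable(2)[OF \<gamma> borel_measurable_norm_powr X']
          coupling_integrable(1)[OF \<gamma> borel_measurable_norm_powr Y'] by simp
      show "fst z \<bullet> snd z \<le> norm (snd z) powr p + norm (fst z) powr p'" for z :: "'a \<times> 'a"
        using inner_le_powr[OF p, of "fst z" "snd z"] by simp
    qed (rule coupling_integrable_inner[OF p \<gamma> Y' X'])
    also have "\<dots> = moment p ?\<nu> + moment p' ?\<xi>"
      using coupling_integrable(2,4)[OF \<gamma> borel_measurable_norm_powr, of p]
        coupling_integrable(1,3)[OF \<gamma> borel_measurable_norm_powr, of p'] X' Y'
      by (simp add: moment_def)
    finally show ?thesis .
  qed
  then have "bdd_below ((\<lambda>\<gamma>. - (\<integral>z. fst z \<bullet> snd z \<partial>\<gamma>)) ` couplings ?\<xi> ?\<nu>)"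
    by (intro bdd_belowI2[of _ "- (moment p ?\<nu> + moment p' ?\<xi>)"] le_imp_neg_le)
  then have "correlation_cost ?\<xi> ?\<nu> \<le> - (\<integral>z. fst z \<bullet> snd z \<partial>distr M borel (\<lambda>\<omega>. (Y \<omega>, X \<omega>)))"
    unfolding correlation_cost_def by (rule cINF_lower) (rule joint_law_coupling[OF assms(3,5,4)])
  moreover have "(\<lambda>z::'a \<times> 'a. fst z \<bullet> snd z) \<in> borel_measurable borel"
    by (intro borel_measurable_continuous_onI continuous_intros)
  ultimately show ?thesis
    by (simp add: integral_joint_law)
qed

lemma expectation_inner_quantized:
  fixes X Y Q :: "'b \<Rightarrow> 'a::euclidean_space"
  assumes [measurable]: "Q \<in> borel_measurable M"
    and X: "integrable M X" and Y [measurable]: "Y \<in> borel_measurable M"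
    and YX: "integrable M (\<lambda>\<omega>. Y \<omega> \<bullet> X \<omega>)"
    and close: "\<And>\<omega>. norm (Y \<omega> - Q \<omega>) \<le> d"
  shows "\<bar>(\<integral>\<omega>. Y \<omega> \<bullet> X \<omega> \<partial>M) - (\<integral>\<omega>. Q \<omega> \<bullet> X \<omega> \<partial>M)\<bar> \<le> d * (\<integral>\<omega>. norm (X \<omega>) \<partial>M)"
proof -
  have [measurable]: "X \<in> borel_measurable M" using X by simp
  have le: "\<bar>(Y \<omega> - Q \<omega>) \<bullet> X \<omega>\<bar> \<le> d * norm (X \<omega>)" for \<omega>
    using Cauchy_Schwarz_ineq2[of "Y \<omega> - Q \<omega>" "X \<omega>"] mult_right_mono[OF close[of \<omega>], of "norm (X \<omega>)"]
    by simp
  have int_d: "integrable M (\<lambda>\<omega>. d * norm (X \<omega>))"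
    using X by simp
  have int: "integrable M (\<lambda>\<omega>. (Y \<omega> - Q \<omega>) \<bullet> X \<omega>)"
    using int_d by (rule Bochner_Integration.integrable_bound)
      (auto intro!: AE_I2 order_trans[OF le abs_ge_self])
  then have "integrable M (\<lambda>\<omega>. Y \<omega> \<bullet> X \<omega> - (Y \<omega> - Q \<omega>) \<bullet> X \<omega>)"
    using YX by (rule Bochner_Integration.integrable_diff[rotated])
  then have "integrable M (\<lambda>\<omega>. Q \<omega> \<bullet> X \<omega>)"
    by (simp add: inner_diff_left)
  then have "(\<integral>\<omega>. Y \<omega> \<bullet> X \<omega> \<partial>M) - (\<integral>\<omega>. Q \<omega> \<bullet> X \<omega> \<partial>M) = (\<integral>\<omega>. (Y \<omega> - Q \<omega>) \<bullet> X \<omega> \<partial>M)"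
    using YX by (simp add: inner_diff_left)
  also have "\<bar>\<dots>\<bar> \<le> (\<integral>\<omega>. \<bar>(Y \<omega> - Q \<omega>) \<bullet> X \<omega>\<bar> \<partial>M)"
    by (rule integral_abs_bound)
  also have "\<dots> \<le> (\<integral>\<omega>. d * norm (X \<omega>) \<partial>M)"
    using int int_d le by (intro integral_mono) auto
  finally show ?thesis by simp
qed

text \<open>
  The index of the first point of a dense sequence within distance \<open>d\<close>.
\<close>

lemma countable_quantization:
  fixes d :: real
  assumes "0 < d"
  obtains u :: "nat \<Rightarrow> 'a::euclidean_space" and idx :: "'a \<Rightarrow> nat"
  where "idx \<in> measurable borel (count_space UNIV)" "\<And>y. norm (y - u (idx y)) \<le> d"
proof -
  obtain D :: "'a set" where D: "countable D" "\<And>S. open S \<Longrightarrow> S \<noteq> {} \<Longrightarrow> \<exists>y\<in>D. y \<in> S"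
    using countable_dense_exists by blast
  define u where "u = from_nat_into D"
  define idx where "idx y = (LEAST n. dist y (u n) < d)" for y
  have "D \<noteq> {}"
    using D(2)[of UNIV] by auto
  have "\<exists>n. dist y (u n) < d" for y
  proof -
    obtain w where "w \<in> D" "w \<in> ball y d"
      using D(2)[of "ball y d"] assms by auto
    moreover obtain n where "w = u n"
      using from_nat_into_surj[OF D(1) \<open>w \<in> D\<close>] by (auto simp: u_def)
    ultimately show ?thesis by auto
  qed
  then have "dist y (u (idx y)) < d" for y
    unfolding idx_def by (rule LeastI_ex)
  then have "norm (y - u (idx y)) \<le> d" for y
    by (simp add: dist_norm less_imp_le)
  moreover have "idx \<in> measurable borel (count_space UNIV)"
    unfolding idx_def by measurable
  ultimately show thesis by (rule that[rotated])
qed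

text \<open>
  Partition the values of \<open>Y\<close> into cells of radius \<open>d\<close> and give \<open>X\<close> the same joint law with the cell
  of \<open>Y\<close> as the second marginal variable of \<open>\<gamma>\<close> has with the cell of the first. For the quantized
  \<open>Y\<close> the expectations of the inner products agree, and on both sides the quantization changes the
  expectation by at most \<open>d E |X|\<close>.
\<close>

lemma exists_nearly_optimal_variable:
  fixes Y :: "('a::euclidean_space measure \<times> real \<Rightarrow> 'a) \<Rightarrow> 'a"
  assumes p: "1 < p" "p' = p / (p - 1)"
    and [measurable]: "Y \<in> borel_measurable universal_space"
    and Y: "integrable universal_space (\<lambda>\<omega>. norm (Y \<omega>) powr p')"
    and \<nu>: "\<nu> \<in> finite_moment_measures p"
    and \<gamma>: "\<gamma> \<in> couplings (distr universal_space borel Y) \<nu>"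
    and "0 < e"
  shows "\<exists>X\<in>borel_measurable universal_space. distr universal_space borel X = \<nu> \<and>
           (\<integral>z. fst z \<bullet> snd z \<partial>\<gamma>) - e \<le> (\<integral>\<omega>. Y \<omega> \<bullet> X \<omega> \<partial>universal_space)"
proof -
  let ?U = "universal_space :: ('a measure \<times> real \<Rightarrow> 'a) measure"
  interpret \<gamma>: prob_space \<gamma> by (rule couplingsD(1)[OF \<gamma>])
  interpret \<nu>: prob_space \<nu> using \<nu> by (simp add: finite_moment_measures_def)
  note [measurable] = coupling_measurable[OF \<gamma>]
  have \<nu>_p: "integrable \<nu> (\<lambda>x. norm x powr p)" and sets_\<nu>: "sets \<nu> = sets borel"
    using \<nu> by (auto simp: finite_moment_measures_def)
  have \<nu>_1: "integrable \<nu> (\<lambda>x. x)"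
    using \<nu>.integrable_if_integrable_powr[OF _ measurable_ident_sets[OF sets_\<nu>] \<nu>_p] p(1) by simp
  define m where "m = (\<integral>x. norm x \<partial>\<nu>)"
  have "m \<ge> 0" by (simp add: m_def)
  define d where "d = e / (2 * (m + 1))"
  have "d > 0" using \<open>0 < e\<close> \<open>m \<ge> 0\<close> by (simp add: d_def)
  obtain u :: "nat \<Rightarrow> 'a" and idx :: "'a \<Rightarrow> nat"
    where [measurable]: "idx \<in> measurable borel (count_space UNIV)"
    and close: "\<And>y. norm (y - u (idx y)) \<le> d"
    using countable_quantization[OF \<open>d > 0\<close>] by metis
  have same: "distr ?U (count_space UNIV) (\<lambda>\<omega>. idx (Y \<omega>)) = distr \<gamma> (count_space UNIV) (\<lambda>z. idx (fst z))"
    using arg_cong[OF couplingsD(3)[OF \<gamma>], of "\<lambda>M. distr M (count_space UNIV) idx"]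
    by (simp add: distr_distr comp_def)
  obtain X where [measurable]: "X \<in> borel_measurable ?U"
    and joint: "distr ?U (count_space UNIV \<Otimes>\<^sub>M borel) (\<lambda>\<omega>. (idx (Y \<omega>), X \<omega>)) =
           distr \<gamma> (count_space UNIV \<Otimes>\<^sub>M borel) (\<lambda>z. (idx (fst z), snd z))"
    using exists_with_joint_cell_law[OF _ \<gamma>.prob_space_axioms _ _ same, of snd] by auto
  have law_X: "distr ?U borel X = \<nu>"
    using arg_cong[OF joint, of "\<lambda>M. distr M borel snd"] couplingsD(4)[OF \<gamma>]
    by (simp add: distr_distr comp_def)
  have "(\<integral>w. u (fst w) \<bullet> snd w \<partial>distr ?U (count_space UNIV \<Otimes>\<^sub>M borel) (\<lambda>\<omega>. (idx (Y \<omega>), X \<omega>))) =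
        (\<integral>w. u (fst w) \<bullet> snd w \<partial>distr \<gamma> (count_space UNIV \<Otimes>\<^sub>M borel) (\<lambda>z. (idx (fst z), snd z)))"
    by (simp only: joint)
  then have quantized: "(\<integral>\<omega>. u (idx (Y \<omega>)) \<bullet> X \<omega> \<partial>?U) = (\<integral>z. u (idx (fst z)) \<bullet> snd z \<partial>\<gamma>)"
    by (simp add: integral_distr)
  have X_p: "integrable ?U (\<lambda>\<omega>. norm (X \<omega>) powr p)"
    using \<nu>_p by (simp add: law_X[symmetric] integrable_distr_eq)
  have X_1: "integrable ?U X" "(\<integral>\<omega>. norm (X \<omega>) \<partial>?U) = m"
    using \<nu>_1 by (simp_all add: m_def law_X[symmetric] integrable_distr_eq integral_distr)
  have snd_1: "integrable \<gamma> snd" "(\<integral>z. norm (snd z) \<partial>\<gamma>) = m"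
    using \<nu>_1 by (simp_all add: m_def couplingsD(4)[OF \<gamma>, symmetric] integrable_distr_eq integral_distr)
  have "\<bar>(\<integral>\<omega>. Y \<omega> \<bullet> X \<omega> \<partial>?U) - (\<integral>\<omega>. u (idx (Y \<omega>)) \<bullet> X \<omega> \<partial>?U)\<bar> \<le> d * m"
    using expectation_inner_quantized[of "\<lambda>\<omega>. u (idx (Y \<omega>))" ?U X Y d] X_1
      integrable_inner[OF p _ _ X_p Y] close by simp
  moreover have "\<bar>(\<integral>z. fst z \<bullet> snd z \<partial>\<gamma>) - (\<integral>z. u (idx (fst z)) \<bullet> snd z \<partial>\<gamma>)\<bar> \<le> d * m"
    using expectation_inner_quantized[of "\<lambda>z. u (idx (fst z))" \<gamma> snd fst d] snd_1
      coupling_integrable_inner[OF p \<gamma> _ \<nu>_p] Y close by (simp add: integrable_distr_eq)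
  moreover have "2 * (d * m) \<le> e"
    using \<open>0 < e\<close> \<open>m \<ge> 0\<close> by (simp add: d_def field_simps)
  ultimately have "(\<integral>z. fst z \<bullet> snd z \<partial>\<gamma>) - e \<le> (\<integral>\<omega>. Y \<omega> \<bullet> X \<omega> \<partial>?U)"
    using quantized by linarith
  with law_X show ?thesis by (intro bexI[of _ X] conjI) auto
qed

lemma correlation_cost_approximated:
  fixes Y :: "('a::euclidean_space measure \<times> real \<Rightarrow> 'a) \<Rightarrow> 'a"
  assumes p: "1 < p" "p' = p / (p - 1)"
    and [measurable]: "Y \<in> borel_measurable universal_space"
    and Y: "integrable universal_space (\<lambda>\<omega>. norm (Y \<omega>) powr p')"
    and \<nu>: "\<nu> \<in> finite_moment_measures p" and "0 < e"
  shows "\<exists>X\<in>borel_measurable universal_space. distr universal_space borel X = \<nu> \<and>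
           - correlation_cost (distr universal_space borel Y) \<nu> - e \<le> (\<integral>\<omega>. Y \<omega> \<bullet> X \<omega> \<partial>universal_space)"
proof -
  let ?\<xi> = "distr universal_space borel Y"
  let ?J = "\<lambda>\<gamma> :: ('a \<times> 'a) measure. - (\<integral>z. fst z \<bullet> snd z \<partial>\<gamma>)"
  have ne: "couplings ?\<xi> \<nu> \<noteq> {}"
    using \<nu> by (intro couplings_nonempty universal.prob_space_distr)
      (auto simp: finite_moment_measures_def)
  have "\<exists>\<gamma>\<in>couplings ?\<xi> \<nu>. ?J \<gamma> \<le> correlation_cost ?\<xi> \<nu> + e / 2"
  proof (rule ccontr)
    assume "\<not> ?thesis"
    then have "correlation_cost ?\<xi> \<nu> + e / 2 \<le> (INF \<gamma>\<in>couplings ?\<xi> \<nu>. ?J \<gamma>)"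
      using ne by (intro cINF_greatest) auto
    then show False
      using \<open>0 < e\<close> by (simp add: correlation_cost_def)
  qed
  then obtain \<gamma> where \<gamma>: "\<gamma> \<in> couplings ?\<xi> \<nu>" "?J \<gamma> \<le> correlation_cost ?\<xi> \<nu> + e / 2"
    by blast
  obtain X where "X \<in> borel_measurable universal_space" "distr universal_space borel X = \<nu>"
    "(\<integral>z. fst z \<bullet> snd z \<partial>\<gamma>) - e / 2 \<le> (\<integral>\<omega>. Y \<omega> \<bullet> X \<omega> \<partial>universal_space)"
    using exists_nearly_optimal_variable[OF p assms(3) Y \<nu> \<gamma>(1), of "e / 2"] \<open>0 < e\<close> by auto
  then show ?thesis
    using \<gamma>(2) by (intro bexI[of _ X] conjI) auto
qed

section \<open>Convergence in mean of order p\<close>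

lemma norm_le_threshold_powr:
  fixes x :: "'a::euclidean_space"
  assumes "1 \<le> p" "0 < t"
  shows "norm x \<le> t + t powr (1 - p) * norm x powr p"
proof -
  have "norm x / t \<le> 1 + norm x powr p / t powr p"
    using norm_le_one_plus_powr[OF assms(1), of "(1 / t) *\<^sub>R x"] assms(2)
    by (simp add: powr_divide)
  then have "t * (norm x / t) \<le> t * (1 + norm x powr p / t powr p)"
    using assms(2) by (intro mult_left_mono) auto
  moreover have "t powr (1 - p) = t / t powr p"
    using assms(2) by (simp add: powr_diff)
  ultimately show ?thesis
    using assms(2) by (simp add: distrib_left)
qed

text \<open>
  A Cauchy sequence in the mean of order \<open>p\<close> is Cauchy in \<open>L\<^sup>1\<close>, so a subsequence converges almost surely.
  Fatou's lemma shows that its limit is the limit of the whole sequence in the mean of order \<open>p\<close>.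
\<close>

lemma (in prob_space) mean_powr_complete:
  fixes X :: "nat \<Rightarrow> 'a \<Rightarrow> 'b::euclidean_space"
  assumes "1 < p" and [measurable]: "\<And>n. X n \<in> borel_measurable M"
    and X_p: "\<And>n. integrable M (\<lambda>\<omega>. norm (X n \<omega>) powr p)"
    and Cauchy: "\<And>e. 0 < e \<Longrightarrow> \<exists>N. \<forall>i\<ge>N. \<forall>j\<ge>N. (\<integral>\<omega>. norm (X i \<omega> - X j \<omega>) powr p \<partial>M) \<le> e"
  obtains Z r where "Z \<in> borel_measurable M" "integrable M (\<lambda>\<omega>. norm (Z \<omega>) powr p)"
    "(\<lambda>n. \<integral>\<omega>. norm (X n \<omega> - Z \<omega>) powr p \<partial>M) \<longlonglongrightarrow> 0"
    "strict_mono r" "AE \<omega> in M. (\<lambda>k. X (r k) \<omega>) \<longlonglongrightarrow> Z \<omega>"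
proof -
  have X_1: "integrable M (X n)" for n
    using assms(1) integrable_if_integrable_powr[OF _ assms(2) X_p] by simp
  have diff_p: "integrable M (\<lambda>\<omega>. norm (X i \<omega> - X j \<omega>) powr p)" for i j
    using assms(1) integrable_norm_diff_powr[OF _ assms(2) assms(2) X_p X_p] by simp
  have "\<exists>N. \<forall>i\<ge>N. \<forall>j\<ge>N. (\<integral>\<omega>. norm (X i \<omega> - X j \<omega>) \<partial>M) < e" if "0 < e" for e
  proof -
    define t where "t = e / 3"
    have "0 < t" using that by (simp add: t_def)
    obtain N where N: "\<And>i j. i \<ge> N \<Longrightarrow> j \<ge> N \<Longrightarrow> (\<integral>\<omega>. norm (X i \<omega> - X j \<omega>) powr p \<partial>M) \<le> t / t powr (1 - p)"
      using Cauchy[of "t / t powr (1 - p)"] \<open>0 < t\<close> by auto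
    have "(\<integral>\<omega>. norm (X i \<omega> - X j \<omega>) \<partial>M) < e" if "i \<ge> N" "j \<ge> N" for i j
    proof -
      have "(\<integral>\<omega>. norm (X i \<omega> - X j \<omega>) \<partial>M) \<le> (\<integral>\<omega>. t + t powr (1 - p) * norm (X i \<omega> - X j \<omega>) powr p \<partial>M)"
      proof (rule integral_mono)
        show "integrable M (\<lambda>\<omega>. norm (X i \<omega> - X j \<omega>))"
          using X_1 by simp
        show "integrable M (\<lambda>\<omega>. t + t powr (1 - p) * norm (X i \<omega> - X j \<omega>) powr p)"
          using diff_p by simp
        show "norm (X i \<omega> - X j \<omega>) \<le> t + t powr (1 - p) * norm (X i \<omega> - X j \<omega>) powr p" for \<omega>
          using norm_le_threshold_powr[of p t] assms(1) \<open>0 < t\<close> by simp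
      qed
      also have "\<dots> = t + t powr (1 - p) * (\<integral>\<omega>. norm (X i \<omega> - X j \<omega>) powr p \<partial>M)"
        using diff_p by (simp add: prob_space)
      also have "\<dots> \<le> t + t powr (1 - p) * (t / t powr (1 - p))"
        using N[OF that] by (intro add_left_mono mult_left_mono) auto
      also have "\<dots> < e"
        using \<open>0 < t\<close> by (simp add: t_def)
      finally show ?thesis .
    qed
    then show ?thesis by blast
  qed
  from cauchy_L1_AE_cauchy_subseq[OF X_1 this]
  obtain r where r: "strict_mono r" "AE \<omega> in M. Cauchy (\<lambda>k. X (r k) \<omega>)"
    by blast
  define Z where "Z \<omega> = lim (\<lambda>k. X (r k) \<omega>)" for \<omega>
  have Z [measurable]: "Z \<in> borel_measurable M"
    unfolding Z_def by (rule borel_measurable_lim_metric) measurable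
  have conv: "AE \<omega> in M. (\<lambda>k. X (r k) \<omega>) \<longlonglongrightarrow> Z \<omega>"
    using r(2) by eventually_elim (simp add: Z_def Cauchy_convergent_iff convergent_LIMSEQ_iff)
  have Fatou: "(\<integral>\<^sup>+\<omega>. ennreal (norm (X n \<omega> - Z \<omega>) powr p) \<partial>M) \<le> ennreal e"
    if N: "\<And>i j. i \<ge> N \<Longrightarrow> j \<ge> N \<Longrightarrow> (\<integral>\<omega>. norm (X i \<omega> - X j \<omega>) powr p \<partial>M) \<le> e" and "n \<ge> N" for n N e
  proof -
    have "AE \<omega> in M. ennreal (norm (X n \<omega> - Z \<omega>) powr p) =
        liminf (\<lambda>k. ennreal (norm (X n \<omega> - X (r k) \<omega>) powr p))"
      using conv
    proof eventually_elim
      case (elim \<omega>)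
      have "(\<lambda>k. norm (X n \<omega> - X (r k) \<omega>) powr p) \<longlonglongrightarrow> norm (X n \<omega> - Z \<omega>) powr p"
        using assms(1) elim by (intro tendsto_powr' tendsto_intros) auto
      then have "(\<lambda>k. ennreal (norm (X n \<omega> - X (r k) \<omega>) powr p)) \<longlonglongrightarrow> ennreal (norm (X n \<omega> - Z \<omega>) powr p)"
        by (rule tendsto_ennrealI)
      then show ?case
        by (rule lim_imp_Liminf[OF sequentially_bot, symmetric])
    qed
    then have "(\<integral>\<^sup>+\<omega>. ennreal (norm (X n \<omega> - Z \<omega>) powr p) \<partial>M) =
        (\<integral>\<^sup>+\<omega>. liminf (\<lambda>k. ennreal (norm (X n \<omega> - X (r k) \<omega>) powr p)) \<partial>M)"
      by (rule nn_integral_cong_AE)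
    also have "\<dots> \<le> liminf (\<lambda>k. \<integral>\<^sup>+\<omega>. ennreal (norm (X n \<omega> - X (r k) \<omega>) powr p) \<partial>M)"
      by (rule nn_integral_liminf) measurable
    also have "\<dots> \<le> limsup (\<lambda>k. \<integral>\<^sup>+\<omega>. ennreal (norm (X n \<omega> - X (r k) \<omega>) powr p) \<partial>M)"
      by (rule Liminf_le_Limsup) simp
    also have "\<dots> \<le> ennreal e"
    proof (rule Limsup_bounded)
      have "(\<integral>\<^sup>+\<omega>. ennreal (norm (X n \<omega> - X (r k) \<omega>) powr p) \<partial>M) \<le> ennreal e" if "k \<ge> N" for k
      proof -
        have "r k \<ge> N" using seq_suble[OF r(1), of k] that by simp
        then show ?thesis
          using N[OF \<open>n \<ge> N\<close>] diff_p by (simp add: nn_integral_eq_integral ennreal_leI)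
      qed
      then show "\<forall>\<^sub>F k in sequentially. (\<integral>\<^sup>+\<omega>. ennreal (norm (X n \<omega> - X (r k) \<omega>) powr p) \<partial>M) \<le> ennreal e"
        by (auto simp: eventually_sequentially)
    qed
    finally show ?thesis .
  qed
  have "integrable M (\<lambda>\<omega>. norm (Z \<omega>) powr p)"
  proof -
    obtain N where "\<And>i j. i \<ge> N \<Longrightarrow> j \<ge> N \<Longrightarrow> (\<integral>\<omega>. norm (X i \<omega> - X j \<omega>) powr p \<partial>M) \<le> 1"
      using Cauchy[of 1] by auto
    then have "(\<integral>\<^sup>+\<omega>. ennreal (norm (X N \<omega> - Z \<omega>) powr p) \<partial>M) < \<infinity>"
      using Fatou[of N 1 N] by (auto simp: ennreal_1[symmetric] intro: le_less_trans simp del: ennreal_1)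
    then have "integrable M (\<lambda>\<omega>. norm (X N \<omega> - Z \<omega>) powr p)"
      by (intro integrableI_bounded) auto
    from integrable_norm_diff_powr[OF _ assms(2)[of N] _ X_p[of N] this]
    have "integrable M (\<lambda>\<omega>. norm (X N \<omega> - (X N \<omega> - Z \<omega>)) powr p)"
      using assms(1) by simp
    then show ?thesis by simp
  qed
  moreover have "(\<lambda>n. \<integral>\<omega>. norm (X n \<omega> - Z \<omega>) powr p \<partial>M) \<longlonglongrightarrow> 0"
  proof (rule LIMSEQ_I)
    fix e :: real assume "0 < e"
    then obtain N where N: "\<And>i j. i \<ge> N \<Longrightarrow> j \<ge> N \<Longrightarrow> (\<integral>\<omega>. norm (X i \<omega> - X j \<omega>) powr p \<partial>M) \<le> e / 2"
      using Cauchy[of "e / 2"] by auto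
    have "(\<integral>\<omega>. norm (X n \<omega> - Z \<omega>) powr p \<partial>M) < e" if "n \<ge> N" for n
      using integral_real_bounded[OF _ Fatou[OF N that]] \<open>0 < e\<close> by simp
    then show "\<exists>N. \<forall>n\<ge>N. norm ((\<integral>\<omega>. norm (X n \<omega> - Z \<omega>) powr p \<partial>M) - 0) < e"
      by (intro exI[of _ N]) simp
  qed
  ultimately show thesis
    using that Z r(1) conv by blast
qed

text \<open>
  Young's inequality for \<open>l Y\<close> and \<open>(X - Z) / l\<close>: a small \<open>l\<close> makes the contribution of \<open>Y\<close>
  small, and then the other contribution tends to zero.
\<close>

lemma expectation_inner_continuous:
  fixes Y :: "'b \<Rightarrow> 'a::euclidean_space" and X :: "nat \<Rightarrow> 'b \<Rightarrow> 'a"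
  assumes p: "1 < p" "p' = p / (p - 1)"
    and [measurable]: "Y \<in> borel_measurable M" "Z \<in> borel_measurable M" "\<And>n. X n \<in> borel_measurable M"
    and Y: "integrable M (\<lambda>\<omega>. norm (Y \<omega>) powr p')"
    and Z: "integrable M (\<lambda>\<omega>. norm (Z \<omega>) powr p)" and X: "\<And>n. integrable M (\<lambda>\<omega>. norm (X n \<omega>) powr p)"
    and lim: "(\<lambda>n. \<integral>\<omega>. norm (X n \<omega> - Z \<omega>) powr p \<partial>M) \<longlonglongrightarrow> 0"
  shows "(\<lambda>n. \<integral>\<omega>. Y \<omega> \<bullet> X n \<omega> \<partial>M) \<longlonglongrightarrow> (\<integral>\<omega>. Y \<omega> \<bullet> Z \<omega> \<partial>M)"
proof -
  have p': "0 < p'" using p by simp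
  define m where "m = (\<integral>\<omega>. norm (Y \<omega>) powr p' \<partial>M)"
  have "0 \<le> m" by (simp add: m_def)
  have diff_p: "integrable M (\<lambda>\<omega>. norm (X n \<omega> - Z \<omega>) powr p)" for n
    using p(1) integrable_norm_diff_powr[OF _ assms(5) assms(4) X Z] by simp
  have bound: "\<bar>(\<integral>\<omega>. Y \<omega> \<bullet> X n \<omega> \<partial>M) - (\<integral>\<omega>. Y \<omega> \<bullet> Z \<omega> \<partial>M)\<bar> \<le>
      l powr - p * (\<integral>\<omega>. norm (X n \<omega> - Z \<omega>) powr p \<partial>M) + l powr p' * m" if "0 < l" for l n
  proof -
    have le: "\<bar>Y \<omega> \<bullet> (X n \<omega> - Z \<omega>)\<bar> \<le> l powr - p * norm (X n \<omega> - Z \<omega>) powr p + l powr p' * norm (Y \<omega>) powr p'" for \<omega>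
    proof -
      have "Y \<omega> \<bullet> (X n \<omega> - Z \<omega>) = (l *\<^sub>R Y \<omega>) \<bullet> ((1 / l) *\<^sub>R (X n \<omega> - Z \<omega>))"
        using that by simp
      also have "\<bar>\<dots>\<bar> \<le> norm ((1 / l) *\<^sub>R (X n \<omega> - Z \<omega>)) powr p + norm (l *\<^sub>R Y \<omega>) powr p'"
        by (rule inner_le_powr[OF p])
      also have "\<dots> = l powr - p * norm (X n \<omega> - Z \<omega>) powr p + l powr p' * norm (Y \<omega>) powr p'"
        using that by (simp add: powr_mult powr_divide powr_minus_divide)
      finally show ?thesis .
    qed
    have int: "integrable M (\<lambda>\<omega>. Y \<omega> \<bullet> (X n \<omega> - Z \<omega>))"
      by (rule integrable_inner[OF p _ _ diff_p Y]) measurable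
    have "(\<integral>\<omega>. Y \<omega> \<bullet> X n \<omega> \<partial>M) - (\<integral>\<omega>. Y \<omega> \<bullet> Z \<omega> \<partial>M) = (\<integral>\<omega>. Y \<omega> \<bullet> (X n \<omega> - Z \<omega>) \<partial>M)"
      using integrable_inner[OF p _ _ X Y] integrable_inner[OF p _ _ Z Y] by (simp add: inner_diff_right)
    also have "\<bar>\<dots>\<bar> \<le> (\<integral>\<omega>. \<bar>Y \<omega> \<bullet> (X n \<omega> - Z \<omega>)\<bar> \<partial>M)"
      by (rule integral_abs_bound)
    also have "\<dots> \<le> (\<integral>\<omega>. l powr - p * norm (X n \<omega> - Z \<omega>) powr p + l powr p' * norm (Y \<omega>) powr p' \<partial>M)"
      using int diff_p Y le by (intro integral_mono) auto
    also have "\<dots> = l powr - p * (\<integral>\<omega>. norm (X n \<omega> - Z \<omega>) powr p \<partial>M) + l powr p' * m"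
      using diff_p Y by (simp add: m_def)
    finally show ?thesis .
  qed
  show ?thesis
  proof (rule LIMSEQ_I)
    fix e :: real assume "0 < e"
    define l where "l = (e / (2 * (m + 1))) powr (1 / p')"
    have "0 < l" using \<open>0 < e\<close> \<open>0 \<le> m\<close> by (simp add: l_def)
    have "l powr p' = e / (2 * (m + 1))"
      using \<open>0 < e\<close> \<open>0 \<le> m\<close> p' by (simp add: l_def powr_powr)
    then have "l powr p' * (m + 1) = e / 2"
      using \<open>0 \<le> m\<close> by (simp add: field_simps)
    moreover have "l powr p' * m \<le> l powr p' * (m + 1)"
      by (intro mult_left_mono) auto
    ultimately have "l powr p' * m \<le> e / 2"
      by simp
    have "(\<lambda>n. l powr - p * (\<integral>\<omega>. norm (X n \<omega> - Z \<omega>) powr p \<partial>M)) \<longlonglongrightarrow> l powr - p * 0"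
      using lim by (rule tendsto_mult_left)
    then have "\<forall>\<^sub>F n in sequentially. l powr - p * (\<integral>\<omega>. norm (X n \<omega> - Z \<omega>) powr p \<partial>M) < e / 2"
      using \<open>0 < e\<close> by (intro order_tendstoD(2)) auto
    then obtain N where N: "\<And>n. n \<ge> N \<Longrightarrow> l powr - p * (\<integral>\<omega>. norm (X n \<omega> - Z \<omega>) powr p \<partial>M) < e / 2"
      by (auto simp: eventually_sequentially)
    have "\<bar>(\<integral>\<omega>. Y \<omega> \<bullet> X n \<omega> \<partial>M) - (\<integral>\<omega>. Y \<omega> \<bullet> Z \<omega> \<partial>M)\<bar> < e" if "n \<ge> N" for n
      using bound[OF \<open>0 < l\<close>, of n] N[OF that] \<open>l powr p' * m \<le> e / 2\<close> by linarith
    then show "\<exists>N. \<forall>n\<ge>N. norm ((\<integral>\<omega>. Y \<omega> \<bullet> X n \<omega> \<partial>M) - (\<integral>\<omega>. Y \<omega> \<bullet> Z \<omega> \<partial>M)) < e"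
      by auto
  qed
qed

section \<open>Stegall's principle for random variables\<close>

text \<open>
  Jensen's inequality for the power \<open>p'\<close> and the values \<open>s\<^sub>i\<^sup>p\<^sup>-\<^sup>1\<close> with weights \<open>b\<^sub>i\<close>. It results from
  summing the tangent inequalities \<open>p s\<^sub>i\<^sup>p\<^sup>-\<^sup>1 T \<le> T\<^sup>p + (p - 1) s\<^sub>i\<^sup>p\<close>, where \<open>T\<^sup>p\<close> is the weighted mean of
  the \<open>s\<^sub>i\<^sup>p\<close>.
\<close>

lemma powr_weighted_series_le:
  fixes b s :: "nat \<Rightarrow> real"
  assumes p: "1 < p" "p' = p / (p - 1)"
    and b: "\<And>i. 0 < b i" "summable b" and s: "\<And>i. 0 \<le> s i"
    and sp: "summable (\<lambda>i. b i * s i powr p)"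
  shows "summable (\<lambda>i. b i * s i powr (p - 1))"
    and "(\<Sum>i. b i * s i powr (p - 1)) powr p' \<le> (\<Sum>i. b i) powr (p' - 1) * (\<Sum>i. b i * s i powr p)"
proof -
  have tangent: "b i * (p * s i powr (p - 1) * T) \<le> b i * (T powr p + (p - 1) * s i powr p)" if "0 \<le> T" for i T
    using powr_ge_tangent[OF p(1) that s[of i]] b(1)[of i] by (intro mult_left_mono) auto
  have term_le: "b i * s i powr (p - 1) \<le> b i * 1 + (p - 1) * (b i * s i powr p)" for i
  proof -
    have "1 * (b i * s i powr (p - 1)) \<le> p * (b i * s i powr (p - 1))"
      using p(1) b(1)[of i] by (intro mult_right_mono mult_nonneg_nonneg) auto
    also have "\<dots> \<le> b i * (1 powr p + (p - 1) * s i powr p)"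
      using tangent[of 1 i] by (simp add: mult_ac)
    finally show ?thesis by (simp add: algebra_simps)
  qed
  have "summable (\<lambda>i. b i * 1 + (p - 1) * (b i * s i powr p))"
    using b(2) sp by (intro summable_add summable_mult) auto
  then show summ: "summable (\<lambda>i. b i * s i powr (p - 1))"
  proof (rule summable_comparison_test')
    show "norm (b i * s i powr (p - 1)) \<le> b i * 1 + (p - 1) * (b i * s i powr p)" for i
      using term_le[of i] b(1)[of i] by (simp add: abs_mult)
  qed
  define B G where "B = (\<Sum>i. b i)" and "G = (\<Sum>i. b i * s i powr p)"
  have "0 < B" unfolding B_def using b by (intro suminf_pos)
  have "0 \<le> G" unfolding G_def using sp b(1) by (intro suminf_nonneg) (auto simp: less_imp_le)
  have "(\<Sum>i. b i * s i powr (p - 1)) powr p' \<le> B powr (p' - 1) * G"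
  proof (cases "G = 0")
    case True
    then have "b i * s i powr p = 0" for i
      using suminf_eq_zero_iff[OF sp] b(1) by (auto simp: G_def less_imp_le)
    then have "s i = 0" for i
      using b(1)[of i] by (metis mult_eq_0_iff less_irrefl powr_eq_0_iff)
    then show ?thesis using True p by simp
  next
    case False
    then have "0 < G" using \<open>0 \<le> G\<close> by simp
    define T where "T = (G / B) powr (1 / p)"
    have "0 < T" using \<open>0 < G\<close> \<open>0 < B\<close> by (simp add: T_def)
    have Tp: "T powr p = G / B"
      using \<open>0 < G\<close> \<open>0 < B\<close> p by (simp add: T_def powr_powr)
    have "(\<Sum>i. (p * T) * (b i * s i powr (p - 1))) \<le> (\<Sum>i. b i * T powr p + (p - 1) * (b i * s i powr p))"
    proof (rule suminf_le)
      show "(p * T) * (b i * s i powr (p - 1)) \<le> b i * T powr p + (p - 1) * (b i * s i powr p)" for i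
        using tangent[of T i] \<open>0 < T\<close> by (simp add: algebra_simps)
      show "summable (\<lambda>i. (p * T) * (b i * s i powr (p - 1)))"
        using summ by (rule summable_mult)
      show "summable (\<lambda>i. b i * T powr p + (p - 1) * (b i * s i powr p))"
        using b(2) sp by (intro summable_add summable_mult summable_mult2)
    qed
    also have "\<dots> = B * T powr p + (p - 1) * G"
      using b(2) sp unfolding B_def G_def
      by (subst suminf_add[symmetric])
        (auto intro: summable_mult summable_mult2 simp: suminf_mult suminf_mult2[symmetric])
    also have "\<dots> = p * G"
      using \<open>0 < B\<close> Tp by (simp add: algebra_simps)
    finally have "(p * T) * (\<Sum>i. b i * s i powr (p - 1)) \<le> p * G"
      using summ by (simp add: suminf_mult)
    then have "(\<Sum>i. b i * s i powr (p - 1)) \<le> G / T"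
      using \<open>0 < T\<close> p(1) by (simp add: field_simps)
    then have "(\<Sum>i. b i * s i powr (p - 1)) powr p' \<le> (G / T) powr p'"
      using summ b(1) p by (intro powr_mono2 suminf_nonneg) (auto simp: less_imp_le)
    also have "\<dots> = G powr p' / (G / B) powr (p' - 1)"
    proof -
      have "p' / p = p' - 1" using p by (simp add: field_simps)
      then have "T powr p' = (G / B) powr (p' - 1)"
        by (simp add: T_def powr_powr)
      then show ?thesis
        using \<open>0 < G\<close> \<open>0 < T\<close> by (simp add: powr_divide)
    qed
    also have "\<dots> = B powr (p' - 1) * G"
      using \<open>0 < G\<close> \<open>0 < B\<close> by (simp add: powr_divide powr_diff)
    finally show ?thesis .
  qed
  then show "(\<Sum>i. b i * s i powr (p - 1)) powr p' \<le> (\<Sum>i. b i) powr (p' - 1) * (\<Sum>i. b i * s i powr p)"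
    by (simp add: B_def G_def)
qed

lemma AE_summable_if_summable_integrals:
  fixes f :: "nat \<Rightarrow> 'a \<Rightarrow> real"
  assumes "\<And>i. integrable M (f i)" "\<And>i \<omega>. 0 \<le> f i \<omega>" "summable (\<lambda>i. \<integral>\<omega>. f i \<omega> \<partial>M)"
  shows "AE \<omega> in M. summable (\<lambda>i. f i \<omega>)"
proof -
  have [measurable]: "f i \<in> borel_measurable M" for i
    using assms(1) by simp
  have "(\<integral>\<^sup>+\<omega>. (\<Sum>i. ennreal (f i \<omega>)) \<partial>M) = (\<Sum>i. \<integral>\<^sup>+\<omega>. ennreal (f i \<omega>) \<partial>M)"
    by (rule nn_integral_suminf) measurable
  also have "\<dots> = (\<Sum>i. ennreal (\<integral>\<omega>. f i \<omega> \<partial>M))"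
    using assms(1,2) by (simp add: nn_integral_eq_integral)
  also have "\<dots> \<noteq> \<infinity>"
    using assms(2,3) by (simp add: ennreal_suminf_neq_top)
  finally have "AE \<omega> in M. (\<Sum>i. ennreal (f i \<omega>)) \<noteq> \<infinity>"
    by (intro nn_integral_PInf_AE) measurable
  then show ?thesis
    by eventually_elim (use assms(2) in \<open>auto intro: summable_suminf_not_top\<close>)
qed

text \<open>
  The duality map sends a bounded set of \<open>L\<^sup>p\<close> to a bounded set of \<open>L\<^sup>p\<^sup>'\<close>, because
  \<open>|duality_map(x)|\<^sup>p\<^sup>' = |x|\<^sup>p\<close>. So the series converges almost surely, Jensen's inequality bounds its
  \<open>p'\<close>-th moment, and it may be paired with \<open>Z\<close> term by term.
\<close>

lemma (in prob_space) duality_series: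
  fixes X :: "nat \<Rightarrow> 'a \<Rightarrow> 'b::euclidean_space"
  assumes p: "1 < p" "p' = p / (p - 1)"
    and [measurable]: "\<And>i. X i \<in> borel_measurable M"
    and X: "\<And>i. integrable M (\<lambda>\<omega>. norm (X i \<omega>) powr p)"
    and R: "\<And>i. (\<integral>\<omega>. norm (X i \<omega>) powr p \<partial>M) \<le> R"
    and b: "\<And>i. 0 < b i" "summable b"
  defines "Y \<equiv> \<lambda>\<omega>. \<Sum>i. b i *\<^sub>R duality_map p (X i \<omega>)"
  shows "Y \<in> borel_measurable M" "integrable M (\<lambda>\<omega>. norm (Y \<omega>) powr p')"
    and "(\<integral>\<omega>. norm (Y \<omega>) powr p' \<partial>M) \<le> (\<Sum>i. b i) powr p' * R"
    and "Z \<in> borel_measurable M \<Longrightarrow> integrable M (\<lambda>\<omega>. norm (Z \<omega>) powr p) \<Longrightarrow>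
      (\<lambda>i. b i * (\<integral>\<omega>. duality_map p (X i \<omega>) \<bullet> Z \<omega> \<partial>M)) sums (\<integral>\<omega>. Y \<omega> \<bullet> Z \<omega> \<partial>M)"
proof -
  have p': "1 < p'" "(p - 1) * p' = p"
    using p by (simp_all add: less_divide_eq)
  have dual [measurable]: "duality_map p \<in> borel_measurable (borel :: 'b measure)"
    by (intro borel_measurable_continuous_onI continuous_duality_map p)
  show Y [measurable]: "Y \<in> borel_measurable M"
    unfolding Y_def by measurable
  have norm_dual: "norm (duality_map p x) powr p' = norm x powr p" for x :: 'b
    using p' by (simp add: norm_duality_map powr_powr)
  have sp: "summable (\<lambda>i. b i * (\<integral>\<omega>. norm (X i \<omega>) powr p \<partial>M))"
  proof (rule summable_comparison_test')
    show "summable (\<lambda>i. b i * R)" using b(2) by (rule summable_mult2)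
    show "norm (b i * (\<integral>\<omega>. norm (X i \<omega>) powr p \<partial>M)) \<le> b i * R" for i
      using b(1)[of i] R[of i] by (simp add: abs_mult)
  qed
  have AE_sp: "AE \<omega> in M. summable (\<lambda>i. b i * norm (X i \<omega>) powr p)"
    using X b(1) sp by (intro AE_summable_if_summable_integrals) (auto simp: less_imp_le)
  define G where "G \<omega> = (\<Sum>i. b i * norm (X i \<omega>) powr p)" for \<omega>
  have G: "integrable M G" "(\<integral>\<omega>. G \<omega> \<partial>M) = (\<Sum>i. b i * (\<integral>\<omega>. norm (X i \<omega>) powr p \<partial>M))"
    using integrable_suminf[of M "\<lambda>i \<omega>. b i * norm (X i \<omega>) powr p"]
      integral_suminf[of M "\<lambda>i \<omega>. b i * norm (X i \<omega>) powr p"] X AE_sp sp b(1)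
    by (simp_all add: G_def[abs_def] abs_mult less_imp_le)
  have norm_term: "norm (b i *\<^sub>R duality_map p (X i \<omega>)) = b i * norm (X i \<omega>) powr (p - 1)" for i \<omega>
    using b(1)[of i] by (simp add: norm_duality_map)
  have AE_le: "AE \<omega> in M. norm (Y \<omega>) powr p' \<le> (\<Sum>i. b i) powr (p' - 1) * G \<omega>"
    using AE_sp
  proof eventually_elim
    case (elim \<omega>)
    note series = powr_weighted_series_le[OF p b norm_ge_zero elim]
    have "norm (Y \<omega>) \<le> (\<Sum>i. b i * norm (X i \<omega>) powr (p - 1))"
      using summable_norm[of "\<lambda>i. b i *\<^sub>R duality_map p (X i \<omega>)", unfolded norm_term, OF series(1)]
      by (simp only: Y_def)
    then have "norm (Y \<omega>) powr p' \<le> (\<Sum>i. b i * norm (X i \<omega>) powr (p - 1)) powr p'"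
      using p' by (intro powr_mono2) auto
    also note series(2)
    finally show ?case by (simp add: G_def)
  qed
  show Yp: "integrable M (\<lambda>\<omega>. norm (Y \<omega>) powr p')"
  proof (rule Bochner_Integration.integrable_bound)
    show "integrable M (\<lambda>\<omega>. (\<Sum>i. b i) powr (p' - 1) * G \<omega>)"
      using G(1) by simp
    show "AE \<omega> in M. norm (norm (Y \<omega>) powr p') \<le> norm ((\<Sum>i. b i) powr (p' - 1) * G \<omega>)"
      using AE_le by eventually_elim auto
  qed measurable
  have "(\<integral>\<omega>. norm (Y \<omega>) powr p' \<partial>M) \<le> (\<integral>\<omega>. (\<Sum>i. b i) powr (p' - 1) * G \<omega> \<partial>M)"
    using Yp G(1) AE_le by (intro integral_mono_AE) auto
  also have "\<dots> = (\<Sum>i. b i) powr (p' - 1) * (\<Sum>i. b i * (\<integral>\<omega>. norm (X i \<omega>) powr p \<partial>M))"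
    by (simp add: G(2))
  also have "\<dots> \<le> (\<Sum>i. b i) powr (p' - 1) * ((\<Sum>i. b i) * R)"
  proof (rule mult_left_mono)
    have "(\<Sum>i. b i * (\<integral>\<omega>. norm (X i \<omega>) powr p \<partial>M)) \<le> (\<Sum>i. b i * R)"
      using sp b summable_mult2[OF b(2)] R by (intro suminf_le) (auto intro: mult_left_mono less_imp_le)
    then show "(\<Sum>i. b i * (\<integral>\<omega>. norm (X i \<omega>) powr p \<partial>M)) \<le> (\<Sum>i. b i) * R"
      using suminf_mult2[OF b(2)] by simp
  qed simp
  also have "\<dots> = (\<Sum>i. b i) powr p' * R"
    using powr_mult_base[of "\<Sum>i. b i" "p' - 1"] b suminf_nonneg[OF b(2)] by (simp add: less_imp_le mult_ac)
  finally show "(\<integral>\<omega>. norm (Y \<omega>) powr p' \<partial>M) \<le> (\<Sum>i. b i) powr p' * R" .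
  assume [measurable]: "Z \<in> borel_measurable M" and Z: "integrable M (\<lambda>\<omega>. norm (Z \<omega>) powr p)"
  let ?f = "\<lambda>i \<omega>. b i * (duality_map p (X i \<omega>) \<bullet> Z \<omega>)"
  let ?g = "\<lambda>i \<omega>. b i * norm (Z \<omega>) powr p + b i * norm (X i \<omega>) powr p"
  have int: "integrable M (?f i)" for i
    using integrable_inner[OF p _ _ Z, of "\<lambda>\<omega>. duality_map p (X i \<omega>)"] X by (simp add: norm_dual)
  have f_le: "norm (?f i \<omega>) \<le> ?g i \<omega>" for i \<omega>
    using mult_left_mono[OF inner_le_powr[OF p, of "duality_map p (X i \<omega>)" "Z \<omega>"], of "b i"] b(1)[of i]
    by (simp add: norm_dual abs_mult distrib_left)
  have "AE \<omega> in M. summable (\<lambda>i. norm (?f i \<omega>))"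
    using AE_sp
  proof eventually_elim
    case (elim \<omega>)
    have "summable (\<lambda>i. ?g i \<omega>)"
      using elim b(2) by (intro summable_add summable_mult2)
    then show ?case
      by (rule summable_comparison_test'[where N = 0]) (use f_le in simp)
  qed
  moreover have "summable (\<lambda>i. \<integral>\<omega>. norm (?f i \<omega>) \<partial>M)"
  proof (rule summable_comparison_test')
    show "summable (\<lambda>i. b i * (\<integral>\<omega>. norm (Z \<omega>) powr p \<partial>M) + b i * (\<integral>\<omega>. norm (X i \<omega>) powr p \<partial>M))"
      using b(2) sp by (intro summable_add summable_mult2)
    show "norm (\<integral>\<omega>. norm (?f i \<omega>) \<partial>M) \<le> b i * (\<integral>\<omega>. norm (Z \<omega>) powr p \<partial>M) + b i * (\<integral>\<omega>. norm (X i \<omega>) powr p \<partial>M)" for i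
    proof -
      have "(\<integral>\<omega>. norm (?f i \<omega>) \<partial>M) \<le> (\<integral>\<omega>. ?g i \<omega> \<partial>M)"
        using int Z X f_le by (intro integral_mono) auto
      then show ?thesis using Z X by simp
    qed
  qed
  ultimately have "(\<lambda>i. \<integral>\<omega>. ?f i \<omega> \<partial>M) sums (\<integral>\<omega>. (\<Sum>i. ?f i \<omega>) \<partial>M)"
    by (rule sums_integral[OF int])
  moreover have "(\<integral>\<omega>. (\<Sum>i. ?f i \<omega>) \<partial>M) = (\<integral>\<omega>. Y \<omega> \<bullet> Z \<omega> \<partial>M)"
  proof (rule integral_cong_AE)
    show "AE \<omega> in M. (\<Sum>i. ?f i \<omega>) = Y \<omega> \<bullet> Z \<omega>"
      using AE_sp
    proof eventually_elim
      case (elim \<omega>)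
      have "summable (\<lambda>i. b i *\<^sub>R duality_map p (X i \<omega>))"
        by (rule summable_norm_cancel)
          (use powr_weighted_series_le(1)[OF p b norm_ge_zero elim] in \<open>simp only: norm_term\<close>)
      from bounded_linear.suminf[OF bounded_linear_inner_left this, of "Z \<omega>"]
      show ?case by (simp add: Y_def)
    qed
  qed measurable
  ultimately show "(\<lambda>i. b i * (\<integral>\<omega>. duality_map p (X i \<omega>) \<bullet> Z \<omega> \<partial>M)) sums (\<integral>\<omega>. Y \<omega> \<bullet> Z \<omega> \<partial>M)"
    by simp
qed

lemma bregman_expectation:
  fixes X Z :: "'b \<Rightarrow> 'a::euclidean_space"
  assumes "1 < p" and [measurable]: "X \<in> borel_measurable M" "Z \<in> borel_measurable M"
    and X: "integrable M (\<lambda>\<omega>. norm (X \<omega>) powr p)" and Z: "integrable M (\<lambda>\<omega>. norm (Z \<omega>) powr p)"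
  shows "integrable M (\<lambda>\<omega>. bregman p (X \<omega>) (Z \<omega>))"
    and "(\<integral>\<omega>. bregman p (X \<omega>) (Z \<omega>) \<partial>M) = (\<integral>\<omega>. norm (X \<omega>) powr p \<partial>M) +
      (p - 1) * (\<integral>\<omega>. norm (Z \<omega>) powr p \<partial>M) - p * (\<integral>\<omega>. duality_map p (Z \<omega>) \<bullet> X \<omega> \<partial>M)"
proof -
  have [measurable]: "duality_map p \<in> borel_measurable (borel :: 'a measure)"
    by (intro borel_measurable_continuous_onI continuous_duality_map assms)
  have "(p - 1) * (p / (p - 1)) = p"
    using assms(1) by simp
  then have "norm (duality_map p x) powr (p / (p - 1)) = norm x powr p" for x :: 'a
    by (simp add: norm_duality_map powr_powr)
  then have "integrable M (\<lambda>\<omega>. duality_map p (Z \<omega>) \<bullet> X \<omega>)"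
    using integrable_inner[OF assms(1) refl _ _ X, of "\<lambda>\<omega>. duality_map p (Z \<omega>)"] Z by simp
  then show "integrable M (\<lambda>\<omega>. bregman p (X \<omega>) (Z \<omega>))"
    "(\<integral>\<omega>. bregman p (X \<omega>) (Z \<omega>) \<partial>M) = (\<integral>\<omega>. norm (X \<omega>) powr p \<partial>M) +
      (p - 1) * (\<integral>\<omega>. norm (Z \<omega>) powr p \<partial>M) - p * (\<integral>\<omega>. duality_map p (Z \<omega>) \<bullet> X \<omega> \<partial>M)"
    unfolding bregman_def using X Z by simp_all
qed

text \<open>
  On a bounded set the first term of \<open>norm_diff_powr_le_bregman\<close> is made small by the choice of its
  parameter \<open>t\<close>, at the price of a large factor \<open>c\<close> in front of the divergence.
\<close>

lemma expectation_diff_powr_le_bregman: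
  fixes p e R :: real and M :: "'b measure"
  assumes "1 < p" "0 < e" "0 \<le> R"
  defines "S \<equiv> {X :: 'b \<Rightarrow> 'a::euclidean_space. X \<in> borel_measurable M \<and>
      integrable M (\<lambda>\<omega>. norm (X \<omega>) powr p) \<and> (\<integral>\<omega>. norm (X \<omega>) powr p \<partial>M) \<le> R}"
  shows "\<exists>d>0. \<forall>X\<in>S. \<forall>Z\<in>S. (\<integral>\<omega>. bregman p (X \<omega>) (Z \<omega>) \<partial>M) \<le> d \<longrightarrow>
      (\<integral>\<omega>. norm (X \<omega> - Z \<omega>) powr p \<partial>M) \<le> e"
proof -
  define t where "t = e / 4 / (R + 1)"
  have "0 < t" using assms by (simp add: t_def)
  have "R + 1 \<noteq> 0"
    using assms by linarith
  then have "t * (R + 1) = e / 4"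
    by (rule nonzero_eq_divide_eq[THEN iffD1, OF _ t_def])
  moreover have "t * R \<le> t * (R + 1)"
    using \<open>0 < t\<close> by (intro mult_left_mono) auto
  ultimately have tR: "4 * (t * R) \<le> e" by linarith
  obtain c where c: "0 \<le> c" "\<And>x z :: 'a. norm (x - z) powr p \<le> t * (norm x powr p + norm z powr p) + c * bregman p x z"
    using norm_diff_powr_le_bregman[OF assms(1) \<open>0 < t\<close>] by blast
  define d where "d = e / 2 / (c + 1)"
  have "0 < d" using assms c by (simp add: d_def)
  have "c + 1 \<noteq> 0"
    using c by linarith
  then have "d * (c + 1) = e / 2"
    by (rule nonzero_eq_divide_eq[THEN iffD1, OF _ d_def])
  moreover have "d * c \<le> d * (c + 1)"
    using \<open>0 < d\<close> by (intro mult_left_mono) auto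
  ultimately have cd: "2 * (d * c) \<le> e" by linarith
  show ?thesis
  proof (intro exI[of _ d] conjI \<open>0 < d\<close> ballI impI)
    fix X Z assume "X \<in> S" "Z \<in> S"
    then have [measurable]: "X \<in> borel_measurable M" "Z \<in> borel_measurable M"
      and X: "integrable M (\<lambda>\<omega>. norm (X \<omega>) powr p)" and Z: "integrable M (\<lambda>\<omega>. norm (Z \<omega>) powr p)"
      and R: "(\<integral>\<omega>. norm (X \<omega>) powr p \<partial>M) \<le> R" "(\<integral>\<omega>. norm (Z \<omega>) powr p \<partial>M) \<le> R"
      by (auto simp: S_def)
    assume d: "(\<integral>\<omega>. bregman p (X \<omega>) (Z \<omega>) \<partial>M) \<le> d"
    have b: "integrable M (\<lambda>\<omega>. bregman p (X \<omega>) (Z \<omega>))"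
      using assms(1) X Z by (intro bregman_expectation) auto
    have "(\<integral>\<omega>. norm (X \<omega> - Z \<omega>) powr p \<partial>M) \<le>
        (\<integral>\<omega>. t * (norm (X \<omega>) powr p + norm (Z \<omega>) powr p) + c * bregman p (X \<omega>) (Z \<omega>) \<partial>M)"
    proof (rule integral_mono)
      show "integrable M (\<lambda>\<omega>. norm (X \<omega> - Z \<omega>) powr p)"
        using integrable_norm_diff_powr[OF _ _ _ X Z] assms(1) by simp
      show "integrable M (\<lambda>\<omega>. t * (norm (X \<omega>) powr p + norm (Z \<omega>) powr p) + c * bregman p (X \<omega>) (Z \<omega>))"
        using X Z b by simp
    qed (rule c(2))
    also have "\<dots> = t * ((\<integral>\<omega>. norm (X \<omega>) powr p \<partial>M) + (\<integral>\<omega>. norm (Z \<omega>) powr p \<partial>M)) +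
        c * (\<integral>\<omega>. bregman p (X \<omega>) (Z \<omega>) \<partial>M)"
      using X Z b by simp
    also have "\<dots> \<le> t * (R + R) + c * d"
      using R d c(1) \<open>0 < t\<close> by (intro add_mono mult_left_mono) auto
    also have "\<dots> \<le> e"
      using tR cd by (simp add: algebra_simps)
    finally show "(\<integral>\<omega>. norm (X \<omega> - Z \<omega>) powr p \<partial>M) \<le> e" .
  qed
qed

text \<open>
  The variational principle is applied to \<open>H X = F X + (\<Sum>\<^sub>i a\<^sub>i) E |X|\<^sup>p\<close>. The divergences in the
  perturbation remove exactly the added powers and leave, up to a constant, the linear functional \<open>Y\<close>. The last conjunct
  says that the perturbed problem is well posed: its almost maximizers are close to one another.
\<close>

lemma (in prob_space) stegall_random_variables:
  fixes C :: "('a \<Rightarrow> 'b::euclidean_space) set" and F :: "('a \<Rightarrow> 'b) \<Rightarrow> real"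
  assumes p: "1 < p" "p' = p / (p - 1)"
    and "C \<noteq> {}" and meas: "\<And>X. X \<in> C \<Longrightarrow> X \<in> borel_measurable M"
    and int: "\<And>X. X \<in> C \<Longrightarrow> integrable M (\<lambda>\<omega>. norm (X \<omega>) powr p)"
    and R: "\<And>X. X \<in> C \<Longrightarrow> (\<integral>\<omega>. norm (X \<omega>) powr p \<partial>M) \<le> R"
    and bdd: "bdd_above (F ` C)" and "0 < \<epsilon>"
  shows "\<exists>Y\<in>borel_measurable M. integrable M (\<lambda>\<omega>. norm (Y \<omega>) powr p') \<and>
     (\<integral>\<omega>. norm (Y \<omega>) powr p' \<partial>M) \<le> \<epsilon> \<and>
     (\<forall>e>0. \<exists>\<eta>>0. \<forall>X\<in>C. \<forall>Z\<in>C.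
       (\<forall>W\<in>C. F W + (\<integral>\<omega>. Y \<omega> \<bullet> W \<omega> \<partial>M) - \<eta> \<le> F X + (\<integral>\<omega>. Y \<omega> \<bullet> X \<omega> \<partial>M)) \<longrightarrow>
       (\<forall>W\<in>C. F W + (\<integral>\<omega>. Y \<omega> \<bullet> W \<omega> \<partial>M) - \<eta> \<le> F Z + (\<integral>\<omega>. Y \<omega> \<bullet> Z \<omega> \<partial>M)) \<longrightarrow>
       (\<integral>\<omega>. norm (X \<omega> - Z \<omega>) powr p \<partial>M) \<le> e)"
proof -
  have "1 < p'" using p by (simp add: less_divide_eq)
  obtain X0 where "X0 \<in> C" using \<open>C \<noteq> {}\<close> by blast
  have "0 \<le> R"
    by (rule order_trans[OF _ R[OF \<open>X0 \<in> C\<close>]]) simp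
  let ?N = "\<lambda>X. \<integral>\<omega>. norm (X \<omega>) powr p \<partial>M"
  let ?w = "\<lambda>i. inverse (fact i) :: real"
  have summ_w: "summable ?w"
    using summable_exp[of "1::real"] by simp
  have "0 < suminf ?w" by (intro suminf_pos summ_w) simp
  \<comment> \<open>The sum of the weights of \<open>Y\<close>: \<open>duality_series\<close> bounds the \<open>p'\<close>-th moment of \<open>Y\<close> by
    \<open>\<kappa>\<close> to the power \<open>p'\<close> times \<open>R\<close>.\<close>
  define \<kappa> where "\<kappa> = (\<epsilon> / (R + 1)) powr (1 / p')"
  have "0 < \<kappa>" using \<open>0 < \<epsilon>\<close> \<open>0 \<le> R\<close> by (simp add: \<kappa>_def)
  have \<kappa>R: "\<kappa> powr p' * R \<le> \<epsilon>"
  proof -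
    have "\<kappa> powr p' = \<epsilon> / (R + 1)"
      using \<open>0 < \<epsilon>\<close> \<open>0 \<le> R\<close> \<open>1 < p'\<close> by (simp add: \<kappa>_def powr_powr)
    then have "\<kappa> powr p' * (R + 1) = \<epsilon>"
      using \<open>0 \<le> R\<close> by simp
    moreover have "\<kappa> powr p' * R \<le> \<kappa> powr p' * (R + 1)"
      by (intro mult_left_mono) auto
    ultimately show ?thesis by simp
  qed
  define b where "b i = \<kappa> / suminf ?w * ?w i" for i
  have b: "0 < b i" for i
    using \<open>0 < \<kappa>\<close> \<open>0 < suminf ?w\<close> by (simp add: b_def)
  have summ_b: "summable b"
    unfolding b_def by (intro summable_mult summ_w)
  have sum_b: "suminf b = \<kappa>"
    unfolding b_def using \<open>0 < suminf ?w\<close> by (subst suminf_mult[OF summ_w]) simp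
  define a where "a i = b i / p" for i
  have a: "0 < a i" for i using b p(1) by (simp add: a_def)
  have b_eq: "b i = a i * p" for i using p(1) by (simp add: a_def)
  have summ_a: "summable a" unfolding a_def using summ_b by (rule summable_divide)
  have tail: "(\<lambda>k. (\<Sum>i. a (i + Suc k)) / a k) \<longlonglongrightarrow> 0"
  proof -
    have a_w: "a i = (\<kappa> / suminf ?w / p) * ?w i" for i
      by (simp add: a_def b_def)
    have "(\<Sum>i. a (i + Suc k)) / a k = (\<Sum>i. ?w (i + Suc k)) / ?w k" for k
    proof -
      have "(\<Sum>i. a (i + Suc k)) = (\<kappa> / suminf ?w / p) * (\<Sum>i. ?w (i + Suc k))"
        unfolding a_w by (rule suminf_mult) (rule summable_ignore_initial_segment[OF summ_w])
      then show ?thesis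
        unfolding a_w using \<open>0 < \<kappa>\<close> \<open>0 < suminf ?w\<close> p(1) by simp
    qed
    then show ?thesis using inverse_fact_tail_ratio_tendsto_0 by simp
  qed
  define S where "S = {X :: 'a \<Rightarrow> 'b. X \<in> borel_measurable M \<and>
      integrable M (\<lambda>\<omega>. norm (X \<omega>) powr p) \<and> ?N X \<le> R}"
  have "C \<subseteq> S"
    using meas int R by (auto simp: S_def)
  define H where "H X = F X + suminf a * ?N X" for X
  define D where "D X Z = (\<integral>\<omega>. bregman p (X \<omega>) (Z \<omega>) \<partial>M)" for X Z :: "'a \<Rightarrow> 'b"
  have D_eq: "D X Z = ?N X + (p - 1) * ?N Z - p * (\<integral>\<omega>. duality_map p (Z \<omega>) \<bullet> X \<omega> \<partial>M)"
    if "X \<in> C" "Z \<in> C" for X Z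
    unfolding D_def using that meas int p(1) by (intro bregman_expectation)
  have D_nonneg: "0 \<le> D X Z" for X Z
    unfolding D_def using p(1) by (simp add: bregman_nonneg)
  have D_le: "D X Z \<le> 2 * (p * R)" if "X \<in> C" "Z \<in> C" for X Z
  proof -
    have "D X Z \<le> (\<integral>\<omega>. 2 * (norm (X \<omega>) powr p + (p - 1) * norm (Z \<omega>) powr p) \<partial>M)"
      unfolding D_def using that int p(1) bregman_expectation(1)[OF p(1) meas meas int int, OF that that]
      by (intro integral_mono bregman_le) auto
    also have "\<dots> = 2 * (?N X + (p - 1) * ?N Z)"
      using that int by simp
    also have "\<dots> \<le> 2 * (R + (p - 1) * R)"
      using that R p(1) by (intro mult_left_mono add_mono) auto
    finally show ?thesis by (simp add: algebra_simps)
  qed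
  have D_self: "D X X = 0" for X
    unfolding D_def using p(1) by (simp add: bregman_self)
  have "bdd_above (H ` C)"
  proof -
    obtain u where "\<And>X. X \<in> C \<Longrightarrow> F X \<le> u"
      using bdd by (auto simp: bdd_above_def)
    then have "H X \<le> u + suminf a * R" if "X \<in> C" for X
      unfolding H_def using that R suminf_nonneg[OF summ_a] a
      by (intro add_mono mult_left_mono) (auto simp: less_imp_le)
    then show ?thesis by (auto simp: bdd_above_def)
  qed
  from divergence_variational_principle[where C = C and H = H and D = D and a = a, OF \<open>C \<noteq> {}\<close> this D_nonneg D_le D_self a summ_a tail]
  obtain X where X: "\<And>k. X k \<in> C"
    and max: "\<And>e. 0 < e \<Longrightarrow> \<exists>k. \<exists>\<eta>>0. \<forall>Z\<in>C.
       (\<forall>W\<in>C. H W - (\<Sum>i. a i * D W (X i)) - \<eta> \<le> H Z - (\<Sum>i. a i * D Z (X i)))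
         \<longrightarrow> D Z (X k) \<le> e"
    by blast
  define Y where "Y \<omega> = (\<Sum>i. b i *\<^sub>R duality_map p (X i \<omega>))" for \<omega>
  note series = duality_series[where X = X and b = b and R = R, OF p meas[OF X] int[OF X] R[OF X] b summ_b, folded Y_def]
  define q where "q = (\<Sum>i. (p - 1) * (a i * ?N (X i)))"
  have perturbed: "H Z - (\<Sum>i. a i * D Z (X i)) = F Z + (\<integral>\<omega>. Y \<omega> \<bullet> Z \<omega> \<partial>M) - q" if "Z \<in> C" for Z
  proof -
    have "summable (\<lambda>i. a i * ?N (X i))"
    proof (rule summable_comparison_test')
      show "summable (\<lambda>i. a i * R)" using summ_a by (rule summable_mult2)
      show "norm (a i * ?N (X i)) \<le> a i * R" for i
        using a[of i] R[OF X] by (simp add: abs_mult)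
    qed
    then have "(\<lambda>i. (p - 1) * (a i * ?N (X i))) sums q"
      unfolding q_def by (intro summable_sums summable_mult)
    moreover have "(\<lambda>i. a i * ?N Z) sums (suminf a * ?N Z)"
      by (intro sums_mult2 summable_sums summ_a)
    moreover have "(\<lambda>i. b i * (\<integral>\<omega>. duality_map p (X i \<omega>) \<bullet> Z \<omega> \<partial>M)) sums (\<integral>\<omega>. Y \<omega> \<bullet> Z \<omega> \<partial>M)"
      using series(4)[OF meas[OF that] int[OF that]] .
    ultimately have "(\<lambda>i. a i * ?N Z + (p - 1) * (a i * ?N (X i)) - b i * (\<integral>\<omega>. duality_map p (X i \<omega>) \<bullet> Z \<omega> \<partial>M))
        sums (suminf a * ?N Z + q - (\<integral>\<omega>. Y \<omega> \<bullet> Z \<omega> \<partial>M))"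
      by (intro sums_add sums_diff)
    moreover have "a i * ?N Z + (p - 1) * (a i * ?N (X i)) - b i * (\<integral>\<omega>. duality_map p (X i \<omega>) \<bullet> Z \<omega> \<partial>M) = a i * D Z (X i)" for i
      unfolding D_eq[OF that X] b_eq by (simp add: algebra_simps)
    ultimately have "(\<Sum>i. a i * D Z (X i)) = suminf a * ?N Z + q - (\<integral>\<omega>. Y \<omega> \<bullet> Z \<omega> \<partial>M)"
      by (simp add: sums_iff)
    then show ?thesis by (simp add: H_def)
  qed
  have close: "\<exists>\<eta>>0. \<forall>Z\<in>C. \<forall>Z'\<in>C.
       (\<forall>W\<in>C. F W + (\<integral>\<omega>. Y \<omega> \<bullet> W \<omega> \<partial>M) - \<eta> \<le> F Z + (\<integral>\<omega>. Y \<omega> \<bullet> Z \<omega> \<partial>M)) \<longrightarrow>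
       (\<forall>W\<in>C. F W + (\<integral>\<omega>. Y \<omega> \<bullet> W \<omega> \<partial>M) - \<eta> \<le> F Z' + (\<integral>\<omega>. Y \<omega> \<bullet> Z' \<omega> \<partial>M)) \<longrightarrow>
       (\<integral>\<omega>. norm (Z \<omega> - Z' \<omega>) powr p \<partial>M) \<le> e" if "0 < e" for e
  proof -
    \<comment> \<open>Two almost maximizers are compared through some \<open>X\<^sub>k\<close>; the triangle inequality for \<open>p\<close>-th powers
    costs the factor \<open>2\<^sup>p\<close>.\<close>
  define e' where "e' = e / (2 * 2 powr p)"
    have "0 < e'" using that by (simp add: e'_def)
    obtain d where "0 < d" and d_all: "\<forall>Z\<in>S. \<forall>Z'\<in>S. D Z Z' \<le> d \<longrightarrow> ?N (\<lambda>\<omega>. Z \<omega> - Z' \<omega>) \<le> e'"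
      using expectation_diff_powr_le_bregman[where ?'a = 'b and M = M,
          OF p(1) \<open>0 < e'\<close> \<open>0 \<le> R\<close>, folded S_def D_def]
      by (elim exE conjE)
    have d: "?N (\<lambda>\<omega>. Z \<omega> - Z' \<omega>) \<le> e'" if "Z \<in> C" "Z' \<in> C" "D Z Z' \<le> d" for Z Z'
      using d_all \<open>C \<subseteq> S\<close> that by blast
    obtain k \<eta> where "0 < \<eta>" and \<eta>: "\<forall>Z\<in>C.
       (\<forall>W\<in>C. H W - (\<Sum>i. a i * D W (X i)) - \<eta> \<le> H Z - (\<Sum>i. a i * D Z (X i))) \<longrightarrow> D Z (X k) \<le> d"
      using max[OF \<open>0 < d\<close>] by (elim exE conjE)
    have near: "?N (\<lambda>\<omega>. Z \<omega> - X k \<omega>) \<le> e'"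
      if "Z \<in> C" "\<forall>W\<in>C. F W + (\<integral>\<omega>. Y \<omega> \<bullet> W \<omega> \<partial>M) - \<eta> \<le> F Z + (\<integral>\<omega>. Y \<omega> \<bullet> Z \<omega> \<partial>M)" for Z
    proof (rule d[OF that(1) X \<eta>[THEN bspec, THEN mp, OF that(1)]], intro ballI)
      fix W assume "W \<in> C"
      then show "H W - (\<Sum>i. a i * D W (X i)) - \<eta> \<le> H Z - (\<Sum>i. a i * D Z (X i))"
        using that(2)[THEN bspec, OF \<open>W \<in> C\<close>]
        unfolding perturbed[OF \<open>W \<in> C\<close>] perturbed[OF that(1)] by linarith
    qed
    have "?N (\<lambda>\<omega>. Z \<omega> - Z' \<omega>) \<le> e"
      if Z: "Z \<in> C" "\<forall>W\<in>C. F W + (\<integral>\<omega>. Y \<omega> \<bullet> W \<omega> \<partial>M) - \<eta> \<le> F Z + (\<integral>\<omega>. Y \<omega> \<bullet> Z \<omega> \<partial>M)"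
        and Z': "Z' \<in> C" "\<forall>W\<in>C. F W + (\<integral>\<omega>. Y \<omega> \<bullet> W \<omega> \<partial>M) - \<eta> \<le> F Z' + (\<integral>\<omega>. Y \<omega> \<bullet> Z' \<omega> \<partial>M)" for Z Z'
    proof -
      have p0: "0 \<le> p" using p(1) by simp
      have i: "integrable M (\<lambda>\<omega>. norm (Z \<omega> - X k \<omega>) powr p)" "integrable M (\<lambda>\<omega>. norm (Z' \<omega> - X k \<omega>) powr p)"
        "integrable M (\<lambda>\<omega>. norm (Z \<omega> - Z' \<omega>) powr p)"
        by (intro integrable_norm_diff_powr p0 meas int X Z(1) Z'(1))+
      have "?N (\<lambda>\<omega>. Z \<omega> - Z' \<omega>) \<le> (\<integral>\<omega>. 2 powr p * (norm (Z \<omega> - X k \<omega>) powr p + norm (Z' \<omega> - X k \<omega>) powr p) \<partial>M)"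
      proof (rule integral_mono)
        show "norm (Z \<omega> - Z' \<omega>) powr p \<le> 2 powr p * (norm (Z \<omega> - X k \<omega>) powr p + norm (Z' \<omega> - X k \<omega>) powr p)" for \<omega>
          using norm_diff_powr_le[OF p0, of "Z \<omega> - X k \<omega>" "Z' \<omega> - X k \<omega>"] by simp
      qed (use i in simp_all)
      also have "\<dots> = 2 powr p * (?N (\<lambda>\<omega>. Z \<omega> - X k \<omega>) + ?N (\<lambda>\<omega>. Z' \<omega> - X k \<omega>))"
        using i by simp
      also have "\<dots> \<le> 2 powr p * (e' + e')"
        by (intro mult_left_mono add_mono near Z Z') simp
      also have "\<dots> = e" by (simp add: e'_def)
      finally show ?thesis .
    qed
    then show ?thesis using \<open>0 < \<eta>\<close> by blast
  qed
  have "(\<integral>\<omega>. norm (Y \<omega>) powr p' \<partial>M) \<le> \<epsilon>"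
    using series(3) \<kappa>R by (simp add: sum_b)
  with close series(1,2) show ?thesis
    by (intro bexI[of _ Y] conjI allI impI)
qed

section \<open>Exposing a law by a small measure\<close>

theorem theorem3p1:
  fixes p p' :: real
    and \<O> :: "'a::euclidean_space set"
    and K :: "'a measure set"
    and f :: "'a measure \<Rightarrow> real"
    and \<epsilon> :: real
  assumes "1 < p"
    and "p' = p / (p - 1)"
    and "closed \<O>"
    and "convex \<O>"
    and "K \<noteq> {}"
    and "K \<subseteq> finite_moment_measures_on p \<O>"
    and "wasserstein_closed_in p (finite_moment_measures_on p \<O>) K"
    and "wasserstein_bounded_in p (finite_moment_measures_on p \<O>) K"
    and "coupling_convex K"
    and "wasserstein_usc_on p K f"
    and "bdd_above (f ` K)"
    and "0 < \<epsilon>"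
  shows "\<exists>\<xi> \<in> finite_moment_measures p'. moment p' \<xi> \<le> \<epsilon> \<and>
           (\<exists>\<mu>. strongly_exposed_max p K (\<lambda>\<nu>. f \<nu> - correlation_cost \<xi> \<nu>) \<mu>)"
proof -
  note p = assms(1,2)
  let ?U = "universal_space :: ('a measure \<times> real \<Rightarrow> 'a) measure"
  let ?law = "distr ?U borel :: (('a measure \<times> real \<Rightarrow> 'a) \<Rightarrow> 'a) \<Rightarrow> 'a measure"
  let ?N = "\<lambda>X :: ('a measure \<times> real \<Rightarrow> 'a) \<Rightarrow> 'a. \<integral>\<omega>. norm (X \<omega>) powr p \<partial>?U"
  define C where "C = {X \<in> borel_measurable ?U. ?law X \<in> K}"
  have K: "\<nu> \<in> finite_moment_measures p" "AE x in \<nu>. x \<in> \<O>" if "\<nu> \<in> K" for \<nu>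
    using that assms(6) by (auto simp: finite_moment_measures_on_def)
  have C_meas: "X \<in> borel_measurable ?U" and C_law: "?law X \<in> K" if "X \<in> C" for X
    using that by (auto simp: C_def)
  have C_int: "integrable ?U (\<lambda>\<omega>. norm (X \<omega>) powr p)" if "X \<in> C" for X
    using K(1)[OF C_law[OF that]] C_meas[OF that]
    by (simp add: finite_moment_measures_def integrable_distr_eq)
  obtain \<mu>0 c where "\<mu>0 \<in> finite_moment_measures p" and c: "\<And>\<nu>. \<nu> \<in> K \<Longrightarrow> wasserstein p \<mu>0 \<nu> \<le> c"
    using assms(8) by (auto simp: wasserstein_bounded_in_def finite_moment_measures_on_def)
  define R where "R = 2 powr p * (moment p \<mu>0 + (c powr p + 1))"
  have C_R: "?N X \<le> R" if "X \<in> C" for X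
  proof -
    have "?N X = moment p (?law X)"
      using C_meas[OF that] by (simp add: moment_def integral_distr)
    also have "\<dots> \<le> R"
      unfolding R_def using C_law[OF that] c K(1) \<open>\<mu>0 \<in> _\<close> p(1) by (intro moment_le_if_wasserstein_le)
    finally show ?thesis .
  qed
  have "C \<noteq> {}"
  proof -
    obtain \<nu> where "\<nu> \<in> K" using assms(5) by blast
    then have "(\<lambda>\<omega>. \<omega> (\<nu>, 0)) \<in> C"
      using K(1)[OF \<open>\<nu> \<in> K\<close>] law_realized[of \<nu> 0] by (simp add: C_def finite_moment_measures_def)
    then show ?thesis by blast
  qed
  have bdd_C: "bdd_above ((\<lambda>X. f (?law X)) ` C)"
    using C_law by (intro bdd_above_mono[OF assms(11)]) auto
  obtain Y where Y [measurable]: "Y \<in> borel_measurable ?U"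
    and Y_int: "integrable ?U (\<lambda>\<omega>. norm (Y \<omega>) powr p')"
    and Y_small: "(\<integral>\<omega>. norm (Y \<omega>) powr p' \<partial>?U) \<le> \<epsilon>"
    and well_posed: "\<forall>e>0. \<exists>\<eta>>0. \<forall>X\<in>C. \<forall>Z\<in>C.
       (\<forall>W\<in>C. f (?law W) + (\<integral>\<omega>. Y \<omega> \<bullet> W \<omega> \<partial>?U) - \<eta> \<le> f (?law X) + (\<integral>\<omega>. Y \<omega> \<bullet> X \<omega> \<partial>?U)) \<longrightarrow>
       (\<forall>W\<in>C. f (?law W) + (\<integral>\<omega>. Y \<omega> \<bullet> W \<omega> \<partial>?U) - \<eta> \<le> f (?law Z) + (\<integral>\<omega>. Y \<omega> \<bullet> Z \<omega> \<partial>?U)) \<longrightarrow>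
       ?N (\<lambda>\<omega>. X \<omega> - Z \<omega>) \<le> e"
    by (rule bexE[OF universal.stegall_random_variables[where C = C and F = "\<lambda>X. f (?law X)",
          OF p \<open>C \<noteq> {}\<close> C_meas C_int C_R bdd_C \<open>0 < \<epsilon>\<close>]], assumption+, elim conjE)
  define \<Psi> where "\<Psi> X = f (?law X) + (\<integral>\<omega>. Y \<omega> \<bullet> X \<omega> \<partial>?U)" for X
  define \<xi> where "\<xi> = ?law Y"
  define g where "g \<nu> = f \<nu> - correlation_cost \<xi> \<nu>" for \<nu>
  have \<xi>: "\<xi> \<in> finite_moment_measures p'" "moment p' \<xi> \<le> \<epsilon>"
    using Y_int Y_small universal.prob_space_distr[OF Y]
    by (simp_all add: \<xi>_def finite_moment_measures_def moment_def integrable_distr_eq integral_distr)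
  \<comment> \<open>The next two facts identify \<open>g \<nu>\<close> with the supremum of \<open>\<Psi>\<close> over the random variables with law \<open>\<nu>\<close>.\<close>
  have \<Psi>_le_g: "\<Psi> X \<le> g (?law X)" if "X \<in> C" for X
    using correlation_cost_le[OF p prob_space_universal_space C_meas[OF that] Y C_int[OF that] Y_int]
    by (simp add: \<Psi>_def g_def \<xi>_def)
  have g_approx: "\<exists>X\<in>C. ?law X = \<nu> \<and> g \<nu> - e \<le> \<Psi> X" if \<nu>: "\<nu> \<in> K" and e: "0 < e" for \<nu> e
  proof -
    obtain X where "X \<in> borel_measurable ?U" "?law X = \<nu>"
      "- correlation_cost \<xi> \<nu> - e \<le> (\<integral>\<omega>. Y \<omega> \<bullet> X \<omega> \<partial>?U)"
      using correlation_cost_approximated[OF p Y Y_int K(1)[OF \<nu>] e] unfolding \<xi>_def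
      by (elim bexE conjE)
    then show ?thesis
      using \<nu> by (intro bexI[of _ X]) (auto simp: C_def \<Psi>_def g_def)
  qed
  have close: "\<exists>\<eta>>0. \<forall>X\<in>C. \<forall>Z\<in>C. (\<forall>W\<in>C. \<Psi> W - \<eta> \<le> \<Psi> X) \<longrightarrow> (\<forall>W\<in>C. \<Psi> W - \<eta> \<le> \<Psi> Z) \<longrightarrow>
      ?N (\<lambda>\<omega>. X \<omega> - Z \<omega>) \<le> e" if "0 < e" for e
    using well_posed[THEN spec, THEN mp, OF that] by (simp only: \<Psi>_def)
  have bdd: "bdd_above (\<Psi> ` C)"
  proof -
    obtain u where u: "\<And>\<nu>. \<nu> \<in> K \<Longrightarrow> f \<nu> \<le> u"
      using assms(11) by (auto simp: bdd_above_def)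
    have "\<Psi> X \<le> u + (R + \<epsilon>)" if "X \<in> C" for X
    proof -
      note [measurable] = C_meas[OF that]
      have "(\<integral>\<omega>. Y \<omega> \<bullet> X \<omega> \<partial>?U) \<le> (\<integral>\<omega>. norm (X \<omega>) powr p + norm (Y \<omega>) powr p' \<partial>?U)"
      proof (rule integral_mono)
        show "integrable ?U (\<lambda>\<omega>. Y \<omega> \<bullet> X \<omega>)"
          by (rule integrable_inner[OF p _ _ C_int[OF that] Y_int]) measurable
        show "integrable ?U (\<lambda>\<omega>. norm (X \<omega>) powr p + norm (Y \<omega>) powr p')"
          using C_int[OF that] Y_int by simp
        show "Y \<omega> \<bullet> X \<omega> \<le> norm (X \<omega>) powr p + norm (Y \<omega>) powr p'" for \<omega>
          using inner_le_powr[OF p, of "Y \<omega>" "X \<omega>"] by simp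
      qed
      also have "\<dots> = ?N X + (\<integral>\<omega>. norm (Y \<omega>) powr p' \<partial>?U)"
        using C_int[OF that] Y_int by simp
      also have "\<dots> \<le> R + \<epsilon>"
        by (intro add_mono C_R that Y_small)
      finally show ?thesis
        unfolding \<Psi>_def using u[OF C_law[OF that]] by linarith
    qed
    then show ?thesis by (auto simp: bdd_above_def)
  qed
  define S where "S = (SUP X\<in>C. \<Psi> X)"
  have \<Psi>_le_S: "\<Psi> X \<le> S" if "X \<in> C" for X
    unfolding S_def using that bdd by (rule cSUP_upper)
  have maximizing_close: "\<exists>\<eta>>0. \<forall>X\<in>C. \<forall>Z\<in>C. S - \<eta> \<le> \<Psi> X \<longrightarrow> S - \<eta> \<le> \<Psi> Z \<longrightarrow>
      ?N (\<lambda>\<omega>. X \<omega> - Z \<omega>) \<le> e" if e: "0 < e" for e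
  proof -
    obtain \<eta> where "0 < \<eta>" and \<eta>: "\<forall>X\<in>C. \<forall>Z\<in>C. (\<forall>W\<in>C. \<Psi> W - \<eta> \<le> \<Psi> X) \<longrightarrow> (\<forall>W\<in>C. \<Psi> W - \<eta> \<le> \<Psi> Z) \<longrightarrow>
      ?N (\<lambda>\<omega>. X \<omega> - Z \<omega>) \<le> e"
      using close[OF e] by (elim exE conjE)
    have "?N (\<lambda>\<omega>. X \<omega> - Z \<omega>) \<le> e" if "X \<in> C" "Z \<in> C" "S - \<eta> \<le> \<Psi> X" "S - \<eta> \<le> \<Psi> Z" for X Z
    proof (rule \<eta>[THEN bspec, THEN bspec, THEN mp, THEN mp, OF that(1,2)]; intro ballI)
      fix W assume "W \<in> C"
      show "\<Psi> W - \<eta> \<le> \<Psi> X" "\<Psi> W - \<eta> \<le> \<Psi> Z"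
        using \<Psi>_le_S[OF \<open>W \<in> C\<close>] that(3,4) by linarith+
    qed
    with \<open>0 < \<eta>\<close> show ?thesis by (intro exI[of _ \<eta>] conjI ballI impI)
  qed
  have "\<exists>X\<in>C. S - inverse (real (Suc n)) < \<Psi> X" for n
    using less_cSUP_iff[OF \<open>C \<noteq> {}\<close> bdd, of "S - inverse (real (Suc n))"] by (simp add: S_def)
  then obtain X where X: "\<And>n. X n \<in> C" and X_max: "\<And>n. S - inverse (real (Suc n)) < \<Psi> (X n)"
    by metis
  have "\<exists>N. \<forall>i\<ge>N. \<forall>j\<ge>N. ?N (\<lambda>\<omega>. X i \<omega> - X j \<omega>) \<le> e" if e: "0 < e" for e
  proof -
    obtain \<eta> where "0 < \<eta>" and \<eta>: "\<forall>X\<in>C. \<forall>Z\<in>C. S - \<eta> \<le> \<Psi> X \<longrightarrow> S - \<eta> \<le> \<Psi> Z \<longrightarrow>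
      ?N (\<lambda>\<omega>. X \<omega> - Z \<omega>) \<le> e"
      using maximizing_close[OF e] by (elim exE conjE)
    obtain N where N: "inverse (real (Suc N)) < \<eta>"
      using reals_Archimedean[OF \<open>0 < \<eta>\<close>] by blast
    have "S - \<eta> \<le> \<Psi> (X i)" if "i \<ge> N" for i
    proof -
      have "inverse (real (Suc i)) \<le> inverse (real (Suc N))"
        using that by (intro le_imp_inverse_le) auto
      then show ?thesis using X_max[of i] N by linarith
    qed
    then show ?thesis
      by (intro exI[of _ N] allI impI \<eta>[THEN bspec, THEN bspec, THEN mp, THEN mp] X)
  qed
  from universal.mean_powr_complete[where X = X, OF p(1) C_meas[OF X] C_int[OF X] this]
  obtain Z r where Z [measurable]: "Z \<in> borel_measurable ?U"
    and Z_int: "integrable ?U (\<lambda>\<omega>. norm (Z \<omega>) powr p)"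
    and X_Z: "(\<lambda>n. ?N (\<lambda>\<omega>. X n \<omega> - Z \<omega>)) \<longlonglongrightarrow> 0"
    and "AE \<omega> in ?U. (\<lambda>k. X (r k) \<omega>) \<longlonglongrightarrow> Z \<omega>"
    by blast
  have powr_0: "(\<lambda>n. h n powr (1 / p)) \<longlonglongrightarrow> 0" if "h \<longlonglongrightarrow> 0" "\<And>n. 0 \<le> h n" for h :: "nat \<Rightarrow> real"
  proof -
    have "(\<lambda>n. h n powr (1 / p)) \<longlonglongrightarrow> 0 powr (1 / p)"
      using that p(1) by (intro tendsto_powr' tendsto_const) auto
    then show ?thesis by simp
  qed
  have wass: "\<forall>\<^sub>F n in sequentially. wasserstein p (?law Z) (?law (X n)) < e" if "0 < e" for e
  proof -
    have "(\<lambda>n. ?N (\<lambda>\<omega>. X n \<omega> - Z \<omega>) powr (1 / p)) \<longlonglongrightarrow> 0"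
      by (rule powr_0[OF X_Z]) simp
    then have "\<forall>\<^sub>F n in sequentially. ?N (\<lambda>\<omega>. X n \<omega> - Z \<omega>) powr (1 / p) < e"
      using that by (rule order_tendstoD(2))
    then show ?thesis
    proof eventually_elim
      case (elim n)
      then show ?case
        using wasserstein_laws_le[OF p(1) prob_space_universal_space Z C_meas[OF X], of n]
        by (simp add: norm_minus_commute)
    qed
  qed
  have "AE \<omega> in ?U. Z \<omega> \<in> \<O>"
  proof -
    have "AE \<omega> in ?U. X n \<omega> \<in> \<O>" for n
      using K(2)[OF C_law[OF X]] C_meas[OF X] borel_closed[OF assms(3)]
      by (subst (asm) AE_distr_iff) auto
    then have "AE \<omega> in ?U. \<forall>n. X n \<omega> \<in> \<O>"
      by (simp add: AE_all_countable)
    with \<open>AE \<omega> in ?U. (\<lambda>k. X (r k) \<omega>) \<longlonglongrightarrow> Z \<omega>\<close> show ?thesis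
    proof eventually_elim
      case (elim \<omega>)
      then show ?case
        using closed_sequentially[OF assms(3), of "\<lambda>k. X (r k) \<omega>"] by blast
    qed
  qed
  then have "AE x in ?law Z. x \<in> \<O>"
    using borel_closed[OF assms(3)] Z by (subst AE_distr_iff) auto
  then have law_Z: "?law Z \<in> finite_moment_measures_on p \<O>"
    using Z_int universal.prob_space_distr[OF Z]
    by (simp add: finite_moment_measures_on_def finite_moment_measures_def integrable_distr_eq)
  have "?law Z \<in> K"
  proof (rule ccontr)
    assume "?law Z \<notin> K"
    then obtain \<rho> where "0 < \<rho>" and far: "\<forall>\<nu>\<in>K. \<not> wasserstein p (?law Z) \<nu> < \<rho>"
      using assms(7) law_Z unfolding wasserstein_closed_in_def by blast
    obtain n where "wasserstein p (?law Z) (?law (X n)) < \<rho>"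
      using eventually_happens'[OF sequentially_bot wass[OF \<open>0 < \<rho>\<close>]] by blast
    then show False using far C_law[OF X] by blast
  qed
  then have "Z \<in> C" by (simp add: C_def)
  have inner_lim: "(\<lambda>n. \<integral>\<omega>. Y \<omega> \<bullet> X n \<omega> \<partial>?U) \<longlonglongrightarrow> (\<integral>\<omega>. Y \<omega> \<bullet> Z \<omega> \<partial>?U)"
    by (rule expectation_inner_continuous[OF p Y Z C_meas[OF X] Y_int Z_int C_int[OF X] X_Z])
  have "S \<le> \<Psi> Z"
  proof (rule field_le_epsilon)
    fix e :: real assume "0 < e"
    then have "0 < e / 3" by simp
    then obtain \<rho> where "0 < \<rho>" and \<rho>: "\<forall>\<nu>\<in>K. wasserstein p (?law Z) \<nu> < \<rho> \<longrightarrow> f \<nu> < f (?law Z) + e / 3"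
      using assms(10) \<open>?law Z \<in> K\<close> unfolding wasserstein_usc_on_def by blast
    have "\<forall>\<^sub>F n in sequentially. inverse (real (Suc n)) < e / 3"
      using LIMSEQ_inverse_real_of_nat \<open>0 < e / 3\<close> by (rule order_tendstoD(2))
    moreover have "\<forall>\<^sub>F n in sequentially. (\<integral>\<omega>. Y \<omega> \<bullet> X n \<omega> \<partial>?U) < (\<integral>\<omega>. Y \<omega> \<bullet> Z \<omega> \<partial>?U) + e / 3"
      using inner_lim \<open>0 < e / 3\<close> by (intro order_tendstoD(2)) auto
    ultimately have "\<forall>\<^sub>F n in sequentially. S \<le> \<Psi> Z + e"
      using wass[OF \<open>0 < \<rho>\<close>]
    proof eventually_elim
      case (elim n)
      have "f (?law (X n)) < f (?law Z) + e / 3"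
        using \<rho> C_law[OF X] elim(3) by blast
      then show ?case
        using elim(1,2) X_max[of n] by (simp add: \<Psi>_def)
    qed
    then show "S \<le> \<Psi> Z + e" by simp
  qed
  have g_le: "g \<nu> \<le> S" if "\<nu> \<in> K" for \<nu>
  proof (rule field_le_epsilon)
    fix e :: real assume "0 < e"
    then show "g \<nu> \<le> S + e"
      using g_approx[OF that \<open>0 < e\<close>] \<Psi>_le_S by force
  qed
  have "S = g (?law Z)"
    using \<open>S \<le> \<Psi> Z\<close> \<Psi>_le_g[OF \<open>Z \<in> C\<close>] g_le[OF \<open>?law Z \<in> K\<close>] by linarith
  then have SUP_g: "(SUP \<nu>\<in>K. g \<nu>) = S"
    using g_le \<open>?law Z \<in> K\<close> by (intro cSup_eq_maximum) auto
  have "strongly_exposed_max p K g (?law Z)"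
    unfolding strongly_exposed_max_def SUP_g
  proof (intro conjI ballI allI impI)
    show "?law Z \<in> K" by fact
    show "g \<nu> \<le> g (?law Z)" if "\<nu> \<in> K" for \<nu>
      using g_le[OF that] \<open>S = g (?law Z)\<close> by simp
    fix s :: "nat \<Rightarrow> 'a measure"
    assume s: "(\<forall>n. s n \<in> K) \<and> (\<lambda>n. g (s n)) \<longlonglongrightarrow> S"
    \<comment> \<open>A maximizing sequence of laws is lifted to a maximizing sequence of random variables.\<close>
    then have "\<exists>V\<in>C. ?law V = s n \<and> g (s n) - inverse (real (Suc n)) \<le> \<Psi> V" for n
      by (intro g_approx) auto
    then obtain V where V: "\<And>n. V n \<in> C" "\<And>n. ?law (V n) = s n"
      and V_max: "\<And>n. g (s n) - inverse (real (Suc n)) \<le> \<Psi> (V n)"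
      by metis
    have lim: "(\<lambda>n. g (s n) - inverse (real (Suc n))) \<longlonglongrightarrow> S"
      using tendsto_diff[OF conjunct2[OF s] LIMSEQ_inverse_real_of_nat] by simp
    have "(\<lambda>n. ?N (\<lambda>\<omega>. V n \<omega> - Z \<omega>)) \<longlonglongrightarrow> 0"
    proof (rule LIMSEQ_I)
      fix e :: real assume "0 < e"
      then have "0 < e / 2" by simp
      obtain \<eta> where "0 < \<eta>" and \<eta>: "\<forall>X\<in>C. \<forall>Z\<in>C. S - \<eta> \<le> \<Psi> X \<longrightarrow> S - \<eta> \<le> \<Psi> Z \<longrightarrow>
        ?N (\<lambda>\<omega>. X \<omega> - Z \<omega>) \<le> e / 2"
        using maximizing_close[OF \<open>0 < e / 2\<close>] by (elim exE conjE)
      have "\<forall>\<^sub>F n in sequentially. S - \<eta> < g (s n) - inverse (real (Suc n))"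
        using lim \<open>0 < \<eta>\<close> by (intro order_tendstoD(1)) auto
      then obtain N where N: "\<forall>n\<ge>N. S - \<eta> < g (s n) - inverse (real (Suc n))"
        by (auto simp: eventually_sequentially)
      have V_le: "?N (\<lambda>\<omega>. V n \<omega> - Z \<omega>) \<le> e / 2" if "n \<ge> N" for n
      proof (rule \<eta>[THEN bspec, THEN bspec, THEN mp, THEN mp, OF V(1) \<open>Z \<in> C\<close>])
        show "S - \<eta> \<le> \<Psi> (V n)"
          using N[THEN spec, THEN mp, OF that] V_max[of n] by linarith
        show "S - \<eta> \<le> \<Psi> Z"
          using \<open>S \<le> \<Psi> Z\<close> \<open>0 < \<eta>\<close> by linarith
      qed
      have "norm (?N (\<lambda>\<omega>. V n \<omega> - Z \<omega>) - 0) < e" if "n \<ge> N" for n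
        using V_le[OF that] \<open>0 < e\<close> by simp
      then show "\<exists>N. \<forall>n\<ge>N. norm (?N (\<lambda>\<omega>. V n \<omega> - Z \<omega>) - 0) < e"
        by blast
    qed
    then have "(\<lambda>n. ?N (\<lambda>\<omega>. V n \<omega> - Z \<omega>) powr (1 / p)) \<longlonglongrightarrow> 0"
      by (rule powr_0) simp
    then show "(\<lambda>n. wasserstein p (s n) (?law Z)) \<longlonglongrightarrow> 0"
    proof (rule tendsto_sandwich[OF _ _ tendsto_const, rotated 2])
      show "\<forall>\<^sub>F n in sequentially. 0 \<le> wasserstein p (s n) (?law Z)"
        by (simp add: wasserstein_def)
      show "\<forall>\<^sub>F n in sequentially. wasserstein p (s n) (?law Z) \<le> ?N (\<lambda>\<omega>. V n \<omega> - Z \<omega>) powr (1 / p)"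
        using wasserstein_laws_le[OF p(1) prob_space_universal_space C_meas[OF V(1)] Z]
        by (simp add: V(2))
    qed
  qed
  then show ?thesis
    using \<xi> unfolding g_def by blast
qed

end
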